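(* If $G$ is a Cayley p.f. linear-time computable group, then the word problem in $G$ can be solved by a deterministic one-tape Turing machine in quadratic time.
   Context: Position-faithful one-tape Turing machine: a Turing machine with one semi-infinite tape (infinite in one direction only) whose left-most cell contains a special symbol $\boxplus$ which occurs only there and cannot be modified. On input $x\in\Sigma^*$ the initial tape content is $\boxplus x\boxdot^\infty$, where $\boxdot$ is a special blank symbol and $\Sigma\cap\{\boxplus,\boxdot\}=\varnothing$, and the head starts at $\boxplus$. The machine computes $f:\Sigma^*\to\Sigma^*$ if on every input $x\in\Sigma^*$ it eventually reaches an accepting state and halts with the tape having prefix $\boxplus f(x)\boxdot$ (no restriction on the tape content after this first $\boxdot$). A function $f:\Sigma^*\to\Sigma^*$ is position-faithful (p.f.) linear-time computable if it is computed by a deterministic position-faithful one-tape Turing machine in time linear in the input length. Let $G$ be a finitely generated group and $S=\{s_1,\dots,s_n\}\subset G$ a finite set of semigroup generators (every $g\in G$ is a product of elements of $S$). $G$ is Cayley p.f. linear-time computable if there exist a language $L\subseteq\Sigma^*$ over a finite alphabet $\Sigma$, a bijection $\psi:L\to G$ and p.f. linear-time computable functions $f_i:\Sigma^*\to\Sigma^*$, $i=1,\dots,n$, with $f_i(L)\subseteq L$ and $\psi(f_i(w))=\psi(w)s_i$ for all $w\in L$. This notion does not depend on the choice of $S$. The word problem in $G$, with respect to a finite generating set $A$ of $G$: given a word $v\in(A\cup A^{-1})^*$, decide whether $v$ represents the identity of $G$; time is measured in the length of $v$. *)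

theory Defs
  imports "HOL-Algebra.Generated_Groups"
begin

section \<open>One-tape Turing machines on a left-bounded tape\<close>

text \<open>
  \<open>End\<close> is the left end marker and \<open>Blank\<close> the blank symbol; both are distinct from
  every input symbol \<open>Letter s\<close>. \<open>Aux x\<close> are further work symbols.
\<close>

datatype ('s, 'x) symbol = End | Blank | Letter 's | Aux 'x

datatype direction = Move_Left | Stay | Move_Right

record ('q, 's, 'x) tm =
  states :: "'q set"
  tape_alphabet :: "('s, 'x) symbol set"
  initial :: 'q
  accepting :: "'q set"
  rejecting :: "'q set"
  trans :: "'q \<Rightarrow> ('s, 'x) symbol \<Rightarrow> 'q \<times> ('s, 'x) symbol \<times> direction"

definition halting :: "('q, 's, 'x) tm \<Rightarrow> 'q set" where
  "halting M = accepting M \<union> rejecting M"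

text \<open>
  The last condition says that the end marker is never modified, never written anywhere
  else, and that the head never tries to leave the tape on the left.
\<close>

definition tm_over :: "'s set \<Rightarrow> ('q, 's, 'x) tm \<Rightarrow> bool" where
  "tm_over \<Sigma> M \<longleftrightarrow>
     finite (states M) \<and> finite (tape_alphabet M) \<and>
     {End, Blank} \<union> Letter ` \<Sigma> \<subseteq> tape_alphabet M \<and>
     initial M \<in> states M \<and>
     accepting M \<subseteq> states M \<and> rejecting M \<subseteq> states M \<and>
     accepting M \<inter> rejecting M = {} \<and>
     (\<forall>q \<in> states M - halting M. \<forall>a \<in> tape_alphabet M. \<forall>q' b d.
        trans M q a = (q', b, d) \<longrightarrow>
          q' \<in> states M \<and> b \<in> tape_alphabet M \<and>
          (b = End \<longleftrightarrow> a = End) \<and> (a = End \<longrightarrow> d \<noteq> Move_Left))"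

text \<open>A configuration consists of the state, the head position and the tape content.\<close>

type_synonym ('q, 's, 'x) config = "'q \<times> nat \<times> (nat \<Rightarrow> ('s, 'x) symbol)"

fun move :: "direction \<Rightarrow> nat \<Rightarrow> nat" where
  "move Move_Left h = h - 1"
| "move Stay h = h"
| "move Move_Right h = h + 1"

fun step :: "('q, 's, 'x) tm \<Rightarrow> ('q, 's, 'x) config \<Rightarrow> ('q, 's, 'x) config" where
  "step M (q, h, t) =
     (if q \<in> halting M then (q, h, t)
      else case trans M q (t h) of (q', b, d) \<Rightarrow> (q', move d h, t(h := b)))"

fun input_tape :: "'s list \<Rightarrow> nat \<Rightarrow> ('s, 'x) symbol" where
  "input_tape w 0 = End"
| "input_tape w (Suc i) = (if i < length w then Letter (w ! i) else Blank)"

definition config_after :: "('q, 's, 'x) tm \<Rightarrow> 's list \<Rightarrow> nat \<Rightarrow> ('q, 's, 'x) config" where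
  "config_after M w n = (step M ^^ n) (initial M, 0, input_tape w)"

definition state_after :: "('q, 's, 'x) tm \<Rightarrow> 's list \<Rightarrow> nat \<Rightarrow> 'q" where
  "state_after M w n = fst (config_after M w n)"

definition tape_after :: "('q, 's, 'x) tm \<Rightarrow> 's list \<Rightarrow> nat \<Rightarrow> nat \<Rightarrow> ('s, 'x) symbol" where
  "tape_after M w n = snd (snd (config_after M w n))"


section \<open>Position-faithful linear-time computable functions\<close>

text \<open>The tape content beyond the first blank after the output is unconstrained.\<close>

definition output_on_tape :: "(nat \<Rightarrow> ('s, 'x) symbol) \<Rightarrow> 's list \<Rightarrow> bool" where
  "output_on_tape t u \<longleftrightarrow>
     t 0 = End \<and> (\<forall>i < length u. t (Suc i) = Letter (u ! i)) \<and> t (Suc (length u)) = Blank"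

text \<open>
  States and work symbols are natural numbers without loss of generality, since the
  machines have finitely many of them.
\<close>

definition pf_linear_time :: "'s set \<Rightarrow> ('s list \<Rightarrow> 's list) \<Rightarrow> bool" where
  "pf_linear_time \<Sigma> f \<longleftrightarrow>
     (\<forall>x \<in> lists \<Sigma>. f x \<in> lists \<Sigma>) \<and>
     (\<exists>(M :: (nat, 's, nat) tm) c. tm_over \<Sigma> M \<and>
        (\<forall>x \<in> lists \<Sigma>. \<exists>n \<le> c * length x + c.
           state_after M x n \<in> accepting M \<and> output_on_tape (tape_after M x n) (f x)))"


section \<open>Deciding languages in quadratic time\<close>

definition quadratic_time_decidable :: "'s set \<Rightarrow> 's list set \<Rightarrow> bool" where
  "quadratic_time_decidable \<Sigma> W \<longleftrightarrow>
     (\<exists>(M :: (nat, 's, nat) tm) c. tm_over \<Sigma> M \<and>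
        (\<forall>x \<in> lists \<Sigma>. \<exists>n \<le> c * (length x)^2 + c.
           state_after M x n \<in> (if x \<in> W then accepting M else rejecting M)))"


section \<open>Cayley position-faithful linear-time computable groups and the word problem\<close>

definition word_value :: "('a, 'm) monoid_scheme \<Rightarrow> 'a list \<Rightarrow> 'a" where
  "word_value G w = foldr (\<lambda>x y. x \<otimes>\<^bsub>G\<^esub> y) w \<one>\<^bsub>G\<^esub>"

definition semigroup_generators :: "('a, 'm) monoid_scheme \<Rightarrow> 'a set \<Rightarrow> bool" where
  "semigroup_generators G S \<longleftrightarrow>
     S \<subseteq> carrier G \<and> (\<forall>g \<in> carrier G. \<exists>w \<in> lists S. w \<noteq> [] \<and> word_value G w = g)"

text \<open>The alphabet consists of natural numbers, which is no restriction as it is finite.\<close>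

definition cayley_pf_linear_time_wrt :: "('a, 'm) monoid_scheme \<Rightarrow> 'a set \<Rightarrow> bool" where
  "cayley_pf_linear_time_wrt G S \<longleftrightarrow>
     (\<exists>(\<Sigma> :: nat set) L \<psi> f. finite \<Sigma> \<and> L \<subseteq> lists \<Sigma> \<and> bij_betw \<psi> L (carrier G) \<and>
        (\<forall>s \<in> S. pf_linear_time \<Sigma> (f s) \<and> f s ` L \<subseteq> L \<and>
           (\<forall>w \<in> L. \<psi> (f s w) = \<psi> w \<otimes>\<^bsub>G\<^esub> s)))"

definition cayley_pf_linear_time :: "('a, 'm) monoid_scheme \<Rightarrow> bool" where
  "cayley_pf_linear_time G \<longleftrightarrow>
     (\<exists>S. finite S \<and> semigroup_generators G S \<and> cayley_pf_linear_time_wrt G S)"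

definition signed_letters :: "('a, 'm) monoid_scheme \<Rightarrow> 'a set \<Rightarrow> 'a set" where
  "signed_letters G A = A \<union> (\<lambda>a. inv\<^bsub>G\<^esub> a) ` A"

definition word_problem :: "('a, 'm) monoid_scheme \<Rightarrow> 'a set \<Rightarrow> 'a list set" where
  "word_problem G A = {v \<in> lists (signed_letters G A). word_value G v = \<one>\<^bsub>G\<^esub>}"

end

theory Submission
  imports Defs
begin

text \<open>
  Let \<open>S\<close> be the semigroup generators of the Cayley presentation, with functions \<open>f s\<close> on words and
  the bijection \<open>\<psi>\<close>, and let \<open>e\<close> be the word with \<open>\<psi> e = 1\<close>. Write every letter of \<open>A \<union> A\<inverse>\<close> as a word
  over \<open>S\<close>. Given \<open>v\<close>, start with \<open>e\<close> and apply \<open>f s\<close> for the generators \<open>s\<close> in the expansion of \<open>v\<close>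
  from left to right. The final word represents the value of \<open>v\<close> (lemma \<open>cayley_walk\<close>), and as \<open>\<psi>\<close> is
  injective, \<open>v\<close> is trivial in the group if and only if the final word is \<open>e\<close>.

  There are \<open>O(|v|)\<close> applications, each linear in the length of the current word, so the time is
  quadratic provided that all intermediate words have length \<open>O(|v|)\<close>. Linear running time alone does
  not give this directly: a factor larger than one in each application would add up to exponential
  growth. The key fact is \<open>linear_time_bounded_growth\<close>: a position-faithful linear-time function
  lengthens its argument by at most a constant. This rests on crossing sequences. Inside a shortest
  input with large growth no two boundaries have the same crossing sequence, for otherwise the
  segment between them could be cut out (\<open>run_on_cut_input\<close>); but the total length of the crossing
  sequences is linear, which allows only a bounded number of distinct ones
  (\<open>distinct_lists_of_small_total_length\<close>).

  The computation is carried out on one tape with two tracks, one for the unread part of \<open>v\<close> and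
  one for the current word (locale \<open>iterated_application\<close>). Position-faithfulness makes this cheap: each
  \<open>f s\<close> finds its argument and leaves its result at the left end of the tape, so that the
  applications can be chained in place. Fetching a letter and cleaning up after an application cost
  a constant number of sweeps over the used part of the tape, which has length \<open>O(|v|)\<close>.
\<close>

section \<open>Runs of a machine\<close>

definition head_after :: "('q, 's, 'x) tm \<Rightarrow> 's list \<Rightarrow> nat \<Rightarrow> nat" where
  "head_after M w n = fst (snd (config_after M w n))"

lemma config_after_eq:
  "config_after M w n = (state_after M w n, head_after M w n, tape_after M w n)"
  by (simp add: state_after_def head_after_def tape_after_def)

lemma config_after_Suc: "config_after M w (Suc n) = step M (config_after M w n)"
  by (simp add: config_after_def)

lemma config_after_0: "config_after M w 0 = (initial M, 0, input_tape w)"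
  by (simp add: config_after_def)

lemma after_0 [simp]:
  "state_after M w 0 = initial M" "head_after M w 0 = 0" "tape_after M w 0 = input_tape w"
  by (simp_all add: state_after_def head_after_def tape_after_def config_after_0)

lemma step_after:
  "step M (state_after M w n, head_after M w n, tape_after M w n) =
     (state_after M w (Suc n), head_after M w (Suc n), tape_after M w (Suc n))"
  by (metis config_after_Suc config_after_eq)

lemma step_after_cases:
  obtains (halted) "state_after M w n \<in> halting M"
      "state_after M w (Suc n) = state_after M w n" "head_after M w (Suc n) = head_after M w n"
      "tape_after M w (Suc n) = tape_after M w n"
    | (moved) q b d where "state_after M w n \<notin> halting M"
      "trans M (state_after M w n) (tape_after M w n (head_after M w n)) = (q, b, d)"
      "state_after M w (Suc n) = q" "head_after M w (Suc n) = move d (head_after M w n)"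
      "tape_after M w (Suc n) = (tape_after M w n)(head_after M w n := b)"
  using step_after[of M w n] by (cases "state_after M w n \<in> halting M") (auto split: prod.splits)

lemma head_after_Suc:
  "head_after M w (Suc n) \<le> head_after M w n + 1"
  "head_after M w n \<le> head_after M w (Suc n) + 1"
proof -
  have m: "move d h \<le> h + 1" "h \<le> move d h + 1" for d h by (cases d; simp)+
  show "head_after M w (Suc n) \<le> head_after M w n + 1"
  proof (cases rule: step_after_cases[of M w n])
    case (moved q b d)
    then show ?thesis using m[where d = d and h = "head_after M w n"] by simp
  qed simp
  show "head_after M w n \<le> head_after M w (Suc n) + 1"
  proof (cases rule: step_after_cases[of M w n])
    case (moved q b d)
    then show ?thesis using m[where d = d and h = "head_after M w n"] by simp
  qed simp
qed

lemma tape_after_Suc: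
  "i \<noteq> head_after M w n \<Longrightarrow> tape_after M w (Suc n) i = tape_after M w n i"
  by (cases rule: step_after_cases[of M w n]) simp_all

lemma funpow_step_halted:
  "q \<in> halting M \<Longrightarrow> (step M ^^ n) (q, h, t) = (q, h, t)"
  by (induction n) auto

lemma config_after_halted:
  assumes "state_after M w n \<in> halting M" "n \<le> m"
  shows "config_after M w m = config_after M w n"
proof -
  obtain k where k: "m = k + n" using assms(2) by (metis le_add_diff_inverse2)
  have "config_after M w m = (step M ^^ k) (config_after M w n)"
    by (simp add: k config_after_def funpow_add)
  also have "\<dots> = config_after M w n"
    using assms(1) by (subst (1 2) config_after_eq) (rule funpow_step_halted)
  finally show ?thesis .
qed

lemma config_after_halted_unique:
  assumes "state_after M w n \<in> halting M" "state_after M w m \<in> halting M"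
  shows "config_after M w m = config_after M w n"
  using config_after_halted[OF assms(1)] config_after_halted[OF assms(2)] by (metis nle_le)

lemma head_after_le: "head_after M w n \<le> n"
proof (induction n)
  case (Suc n) then show ?case using head_after_Suc(1)[of M w n] by linarith
qed simp

lemma tape_after_unvisited: "n \<le> i \<Longrightarrow> tape_after M w n i = input_tape w i"
proof (induction n)
  case (Suc n)
  then show ?case using tape_after_Suc[of i M w n] head_after_le[of M w n] by simp
qed simp

lemma input_tape_beyond: "length w < i \<Longrightarrow> input_tape w i = Blank"
  by (cases i) auto

lemma input_tape_0_iff: "input_tape w i = End \<longleftrightarrow> i = 0"
  by (cases i) auto

text \<open>
  The closure condition of \<open>tm_over\<close> only speaks of symbols of the tape alphabet, so it must be
  propagated along a run; the last conjunct says that the end marker stays where it is.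
\<close>

lemma run_within_machine:
  assumes M: "tm_over \<Sigma> M" and w: "w \<in> lists \<Sigma>"
  shows "state_after M w n \<in> states M \<and> (\<forall>i. tape_after M w n i \<in> tape_alphabet M) \<and>
    (\<forall>i. tape_after M w n i = End \<longleftrightarrow> i = 0)"
proof (induction n)
  case 0
  have "input_tape w i \<in> tape_alphabet M" for i
    using M w by (cases i) (auto simp: tm_over_def in_lists_conv_set)
  then show ?case using M by (auto simp: tm_over_def input_tape_0_iff)
next
  case (Suc n)
  let ?q = "state_after M w n" and ?h = "head_after M w n" and ?t = "tape_after M w n"
  show ?case
  proof (cases rule: step_after_cases[of M w n])
    case halted
    then show ?thesis using Suc by simp
  next
    case (moved q b d)
    have "q \<in> states M \<and> b \<in> tape_alphabet M \<and> (b = End \<longleftrightarrow> ?t ?h = End)"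
      using M moved(1,2) Suc unfolding tm_over_def by (metis DiffI)
    then show ?thesis using Suc moved(3-5) by simp
  qed
qed

text \<open>
  A letter beyond the input must have been written, so its cell was visited, and a run of
  \<open>n\<close> steps does not get beyond cell \<open>n\<close>.
\<close>

lemma output_length_le:
  assumes "output_on_tape (tape_after M w n) u"
  shows "length u \<le> max (length w) n"
proof (rule ccontr)
  assume *: "\<not> ?thesis"
  then obtain k where k: "length u = Suc k" by (cases "length u") auto
  have "tape_after M w n (length u) = input_tape w (length u)"
    using * by (intro tape_after_unvisited) auto
  also have "\<dots> = Blank" using * by (intro input_tape_beyond) auto
  finally show False using assms k by (auto simp: output_on_tape_def)
qed

section \<open>Crossing sequences\<close>

text \<open>
  The crossing sequence at the boundary between the cells \<open>p\<close> and \<open>p + 1\<close>: the states in which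
  the head arrives on the other side. The directions of the crossings need not be recorded, since
  they alternate and the first one goes to the right.
\<close>

primrec crossing_states :: "('q, 's, 'x) tm \<Rightarrow> 's list \<Rightarrow> nat \<Rightarrow> nat \<Rightarrow> 'q list" where
  "crossing_states M w p 0 = []"
| "crossing_states M w p (Suc n) = crossing_states M w p n @
     (if (head_after M w n \<le> p) = (head_after M w (Suc n) \<le> p) then []
      else [state_after M w (Suc n)])"

lemma crossing_states_parity:
  "even (length (crossing_states M w p n)) \<longleftrightarrow> head_after M w n \<le> p"
  by (induction n) auto

lemma set_crossing_states:
  assumes "tm_over \<Sigma> M" "w \<in> lists \<Sigma>"
  shows "set (crossing_states M w p n) \<subseteq> states M"
  using run_within_machine[OF assms] by (induction n) auto

text \<open>
  One step crosses at most one boundary.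
\<close>

lemma sum_crossing_states_le:
  assumes "finite P"
  shows "(\<Sum>p\<in>P. length (crossing_states M w p n)) \<le> n"
proof (induction n)
  case (Suc n)
  let ?h = "head_after M w n" and ?h' = "head_after M w (Suc n)"
  let ?C = "{p\<in>P. (?h \<le> p) \<noteq> (?h' \<le> p)}"
  have "?C \<subseteq> {min ?h ?h'}"
    using head_after_Suc[of M w n] by auto
  then have C: "card ?C \<le> 1"
    using card_mono[of "{min ?h ?h'}" ?C] by simp
  have "(\<Sum>p\<in>P. length (crossing_states M w p (Suc n))) =
      (\<Sum>p\<in>P. length (crossing_states M w p n)) + (\<Sum>p\<in>P. if (?h \<le> p) \<noteq> (?h' \<le> p) then 1 else 0)"
    by (simp add: sum.distrib[symmetric] if_distrib cong: if_cong sum.cong)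
       (rule sum.cong, auto)
  also have "(\<Sum>p\<in>P. if (?h \<le> p) \<noteq> (?h' \<le> p) then 1 else 0) = card ?C"
    using assms by (simp add: sum.If_cases Int_def)
  finally show ?case using Suc C by linarith
qed simp

section \<open>Cutting a segment out of the input\<close>

lemma input_tape_cut:
  assumes "p < q" "q \<le> length w"
  shows "input_tape (take p w @ drop q w) i =
    (if i \<le> p then input_tape w i else input_tape w (i + (q - p)))"
  using assms by (cases i) (auto simp: nth_append algebra_simps)

text \<open>
  The tape that remains of two tapes when the first is kept up to cell \<open>p\<close>, the second is kept
  beyond cell \<open>q\<close>, and the rest is cut out.
\<close>

definition join_halves :: "nat \<Rightarrow> nat \<Rightarrow> (nat \<Rightarrow> 'b) \<Rightarrow> (nat \<Rightarrow> 'b) \<Rightarrow> nat \<Rightarrow> 'b" where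
  "join_halves p q t t' i = (if i \<le> p then t i else t' (i + (q - p)))"

text \<open>
  The part of the tape left of a boundary and the part right of it influence each other only
  through the crossing sequence. Hence if the boundaries \<open>p\<close> and \<open>q\<close> have seen the same crossing
  sequence, the machine on the input with the cells \<open>p + 1, \<dots>, q\<close> removed behaves on the left like
  the original run does left of \<open>p\<close>, and on the right like the original run does right of \<open>q\<close>.

  The two halves are not synchronised in the original run, so the left half is compared with
  time \<open>i\<close> and the right half with a time \<open>j\<close> of its own; the crossing sequences up to these times
  agree, hence the two heads are on the same side of their boundaries, and this side decides which
  of them is the head of the shortened run. The induction on \<open>i + j\<close> removes the last step of the
  left run or of the right run if that step crosses no boundary, and the last steps of both
  otherwise.
\<close>

lemma run_on_cut_input:
  assumes pq: "p < q" "q \<le> length w"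
    and "crossing_states M w p i = crossing_states M w q j"
  shows "\<exists>k. config_after M (take p w @ drop q w) k =
    (if head_after M w i \<le> p then (state_after M w i, head_after M w i, join_halves p q (tape_after M w i) (tape_after M w j))
     else (state_after M w j, head_after M w j - (q - p), join_halves p q (tape_after M w i) (tape_after M w j)))"
  using assms(3)
proof (induction "i + j" arbitrary: i j rule: less_induct)
  case less
  let ?w = "take p w @ drop q w"
  let ?T = "\<lambda>i j. join_halves p q (tape_after M w i) (tape_after M w j)"
  let ?C = "\<lambda>i j. if head_after M w i \<le> p then (state_after M w i, head_after M w i, ?T i j)
     else (state_after M w j, head_after M w j - (q - p), ?T i j)"
  have advance: "\<exists>k. config_after M ?w k = step M c" if "\<exists>k. config_after M ?w k = c" for c
    using that by (metis config_after_Suc)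
  have side: "head_after M w i \<le> p \<longleftrightarrow> head_after M w j \<le> q"
    if "crossing_states M w p i = crossing_states M w q j" for i j
    using that by (metis crossing_states_parity)
  have left_step: "step M (state_after M w i, head_after M w i, ?T i j) =
      (state_after M w (Suc i), head_after M w (Suc i), ?T (Suc i) j)" if "head_after M w i \<le> p" for i j
    using step_after[of M w i] that
    by (auto simp: join_halves_def fun_eq_iff split: if_splits prod.splits)
  have right_step: "step M (state_after M w j, head_after M w j - (q - p), ?T i j) =
      (state_after M w (Suc j), head_after M w (Suc j) - (q - p), ?T i (Suc j))"
    if "q < head_after M w j" for i j
  proof -
    define d where "d = q - p"
    define h where "h = head_after M w j - d"
    have h: "head_after M w j = h + d" "p < h"
      using that pq by (simp_all add: h_def d_def)
    have mv: "move a h = move a (h + d) - d" for a using h(2) by (cases a) auto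
    have read: "?T i j h = tape_after M w j (h + d)"
      using h(2) by (simp add: join_halves_def d_def)
    have st: "step M (state_after M w j, h + d, tape_after M w j) =
        (state_after M w (Suc j), head_after M w (Suc j), tape_after M w (Suc j))"
      using step_after[of M w j] h(1) by simp
    have "step M (state_after M w j, h, ?T i j) =
        (state_after M w (Suc j), head_after M w (Suc j) - d, ?T i (Suc j))"
    proof (cases "state_after M w j \<in> halting M")
      case True
      then have "state_after M w (Suc j) = state_after M w j"
        "head_after M w (Suc j) = h + d" "tape_after M w (Suc j) = tape_after M w j" using st by simp_all
      then show ?thesis using True by simp
    next
      case False
      obtain q' b a where tr: "trans M (state_after M w j) (tape_after M w j (h + d)) = (q', b, a)"
        by (metis prod_cases3)
      then have eqs: "state_after M w (Suc j) = q'" "head_after M w (Suc j) = move a (h + d)"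
        "tape_after M w (Suc j) = (tape_after M w j)(h + d := b)" using st False by simp_all
      have "(?T i j)(h := b) = ?T i (Suc j)"
        using h(2) by (auto simp: join_halves_def eqs(3) d_def[symmetric])
      then show ?thesis using False tr read eqs(1,2) mv by simp
    qed
    then show ?thesis unfolding h_def d_def .
  qed
  have left_idle: "?T (Suc i) j = ?T i j" if "\<not> head_after M w i \<le> p" for i j
    using that by (auto simp: join_halves_def fun_eq_iff intro!: tape_after_Suc)
  have right_idle: "?T i (Suc j) = ?T i j" if "head_after M w j \<le> q" for i j
    using that pq by (auto simp: join_halves_def fun_eq_iff intro!: tape_after_Suc)
  consider (i) i' where "i = Suc i'" "crossing_states M w p i' = crossing_states M w p i"
    | (j) j' where "j = Suc j'" "crossing_states M w q j' = crossing_states M w q j"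
    | (0) "i = 0" "j = 0"
    | (ij) i' j' where "i = Suc i'" "crossing_states M w p i' \<noteq> crossing_states M w p i"
       "j = Suc j'" "crossing_states M w q j' \<noteq> crossing_states M w q j"
  proof -
    have shorter: "crossing_states M w r n = crossing_states M w r (Suc n)"
      if "crossing_states M w r (Suc n) = []" for r n
      using that by simp
    show thesis
    proof (cases i)
      case 0
      then have "crossing_states M w q j = []" using less.prems by simp
      then show thesis using 0 that(2,3) shorter by (cases j) blast+
    next
      case (Suc i')
      show thesis
      proof (cases "crossing_states M w p i' = crossing_states M w p i")
        case True
        then show thesis using that(1) Suc by blast
      next
        case False
        then have "crossing_states M w q j \<noteq> []" using less.prems Suc shorter by metis
        then obtain j' where "j = Suc j'" by (cases j) auto
        then show thesis using that(2,4) Suc False by blast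
      qed
    qed
  qed
  then show ?case
  proof cases
    case i
    \<comment> \<open>No crossing at the last step of the left run: the shortened run makes this step if the head is on
      the left, and the left half is idle otherwise.\<close>
    have s: "head_after M w i' \<le> p \<longleftrightarrow> head_after M w i \<le> p"
      using i by (metis crossing_states_parity)
    have IH: "\<exists>k. config_after M ?w k = ?C i' j"
      by (rule less.hyps) (use i less.prems in auto)
    show ?thesis
    proof (cases "head_after M w i' \<le> p")
      case True
      then show ?thesis using advance[OF IH] s i left_step[of i' j] by simp
    next
      case False
      then show ?thesis using IH s i left_idle[of i' j] by simp
    qed
  next
    case j
    have s: "head_after M w j' \<le> q \<longleftrightarrow> head_after M w j \<le> q"
      using j by (metis crossing_states_parity)
    have IH: "\<exists>k. config_after M ?w k = ?C i j'"
      by (rule less.hyps) (use j less.prems in auto)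
    show ?thesis
    proof (cases "head_after M w j' \<le> q")
      case True
      then show ?thesis using IH s j right_idle[of j' i] side[OF less.prems] by simp
    next
      case False
      then show ?thesis using advance[OF IH] s j right_step[of j' i] side[OF less.prems] by simp
    qed
  next
    case 0
    have "input_tape ?w = join_halves p q (input_tape w) (input_tape w)"
      by (rule ext) (simp add: join_halves_def input_tape_cut[OF pq])
    then show ?thesis using 0 by (auto simp: config_after_0 intro!: exI[of _ 0])
  next
    case ij
    \<comment> \<open>Both runs have just crossed, and they have done so in the same state. The shortened run makes the
      step of the half that the head leaves; the last step of the other run changes no cell that is
      kept.\<close>
    from ij have i: "(head_after M w i' \<le> p) \<noteq> (head_after M w i \<le> p)"
      and j: "(head_after M w j' \<le> q) \<noteq> (head_after M w j \<le> q)" by (auto split: if_splits)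
    with ij less.prems have eq: "crossing_states M w p i' = crossing_states M w q j'"
      "state_after M w i = state_after M w j" by auto
    have IH: "\<exists>k. config_after M ?w k = ?C i' j'"
      by (rule less.hyps) (use ij eq in auto)
    show ?thesis
    proof (cases "head_after M w i' \<le> p")
      case True
      then have "head_after M w j' \<le> q" using side[OF eq(1)] by simp
      then have "head_after M w i = p + 1" "head_after M w j = q + 1"
        using i j True head_after_Suc(1)[of M w i'] head_after_Suc(1)[of M w j'] ij by auto
      then show ?thesis
        using advance[OF IH] ij True left_step[of i' j'] eq(2) pq
          right_idle[OF \<open>head_after M w j' \<le> q\<close>, of i] by simp
    next
      case False
      then have "q < head_after M w j'" using side[OF eq(1)] by simp
      then have "head_after M w i = p" "head_after M w j = q"
        using i j False head_after_Suc(2)[of M w i'] head_after_Suc(2)[of M w j'] ij by auto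
      then show ?thesis
        using advance[OF IH] ij False right_step[OF \<open>q < head_after M w j'\<close>, of i'] eq(2) pq
          left_idle[OF False, of j] by simp
    qed
  qed
qed

section \<open>Linear time adds a bounded number of letters\<close>

lemma output_length_unique:
  assumes "output_on_tape t u" "output_on_tape t v"
  shows "length u = length v"
  using assms unfolding output_on_tape_def
  by (metis linorder_neqE_nat symbol.distinct(7))

text \<open>
  If \<open>n + 1\<close> lists have total length at most \<open>c (n + 1)\<close>, then at least half of them have length
  at most \<open>2 c\<close>. Over a finite set there is a bounded number of lists of that length, so \<open>n\<close> is
  bounded when the lists are distinct.
\<close>

lemma distinct_lists_of_small_total_length:
  assumes "finite Q"
  shows "\<exists>N. \<forall>n (cs :: nat \<Rightarrow> 'q list).
    inj_on cs {..n} \<and> (\<forall>p\<le>n. set (cs p) \<subseteq> Q) \<and> (\<Sum>p\<le>n. length (cs p)) \<le> c * n + c \<longrightarrow> n \<le> N"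
proof -
  define B where "B = {xs. set xs \<subseteq> Q \<and> length xs \<le> 2 * c}"
  have fB: "finite B" unfolding B_def using assms by (rule finite_lists_length_le)
  have "n \<le> 2 * card B" if inj: "inj_on cs {..n}" and Q: "\<forall>p\<le>n. set (cs p) \<subseteq> Q"
    and sum: "(\<Sum>p\<le>n. length (cs p)) \<le> c * n + c" for n and cs :: "nat \<Rightarrow> 'q list"
  proof -
    define X where "X = {p\<in>{..n}. length (cs p) \<le> 2 * c}"
    define Y where "Y = {p\<in>{..n}. 2 * c < length (cs p)}"
    have "cs ` X \<subseteq> B" using Q by (auto simp: X_def B_def)
    then have X: "card X \<le> card B"
      using inj fB by (intro card_inj_on_le[of cs]) (auto simp: X_def inj_on_def)
    have "card Y * (2 * c + 1) = (\<Sum>p\<in>Y. 2 * c + 1)" by simp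
    also have "\<dots> \<le> (\<Sum>p\<in>Y. length (cs p))" by (rule sum_mono) (auto simp: Y_def)
    also have "\<dots> \<le> (\<Sum>p\<le>n. length (cs p))" by (rule sum_mono2) (auto simp: Y_def)
    also have "\<dots> \<le> c * (n + 1)" using sum by simp
    finally have *: "card Y * (2 * c + 1) \<le> c * (n + 1)" .
    have Y: "2 * card Y \<le> n + 1"
    proof (rule ccontr)
      assume "\<not> ?thesis"
      then have "c * (n + 1) \<le> c * (2 * card Y)" "0 < card Y" by (intro mult_le_mono, auto)
      with * have "card Y * (2 * c + 1) \<le> c * (2 * card Y)" by linarith
      then show False using \<open>0 < card Y\<close> by (simp add: algebra_simps)
    qed
    have "{..n} = X \<union> Y" by (auto simp: X_def Y_def)
    then have "n + 1 \<le> card X + card Y" using card_Un_le[of X Y] by (metis card_atMost Suc_eq_plus1)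
    then show ?thesis using X Y by linarith
  qed
  then show ?thesis by blast
qed

text \<open>
  Consider a shortest input \<open>x\<close> whose output is longer by at least \<open>K\<close>. Two boundaries inside \<open>x\<close>
  with the same crossing sequence would allow to cut out the segment between them, which shortens
  input and output by the same amount and so contradicts the choice of \<open>x\<close>. Hence the crossing
  sequences at all \<open>|x| + 1\<close> boundaries are distinct, while their total length is at most the
  running time \<open>c |x| + c\<close>. This bounds \<open>|x|\<close>, the running time and the length of the output
  by constants that do not depend on \<open>K\<close>, which is impossible for large \<open>K\<close>.
\<close>

theorem linear_time_bounded_growth:
  fixes M :: "('q, 's, 'x) tm"
  assumes M: "tm_over \<Sigma> M"
    and run: "\<And>x. x \<in> lists \<Sigma> \<Longrightarrow> \<exists>n \<le> c * length x + c.
      state_after M x n \<in> accepting M \<and> output_on_tape (tape_after M x n) (f x)"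
  shows "\<exists>K. \<forall>x\<in>lists \<Sigma>. length (f x) \<le> length x + K"
proof -
  have "finite (states M)" using M by (simp add: tm_over_def)
  then obtain N where
    N: "\<And>n cs. inj_on cs {..n} \<Longrightarrow> (\<forall>p\<le>n. set (cs p) \<subseteq> states M) \<Longrightarrow>
      (\<Sum>p\<le>n. length (cs p)) \<le> c * n + c \<Longrightarrow> n \<le> N"
    using distinct_lists_of_small_total_length[of "states M" c] by metis
  \<comment> \<open>One more than the time bound for inputs of length at most \<open>N\<close>.\<close>
  define K where "K = c * N + c + 1"
  have "length (f x) < length x + K" if "x \<in> lists \<Sigma>" for x
  proof (rule ccontr)
    assume "\<not> ?thesis"
    with that have ex: "\<exists>x. x \<in> lists \<Sigma> \<and> length x + K \<le> length (f x)" by auto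
    define P where "P x \<longleftrightarrow> x \<in> lists \<Sigma> \<and> length x + K \<le> length (f x)" for x
    obtain x where "P x" and "\<And>y. P y \<Longrightarrow> length x \<le> length y"
      using ex_has_least_nat[of P _ length] ex unfolding P_def by blast
    then have x: "x \<in> lists \<Sigma>" "length x + K \<le> length (f x)"
      and shortest: "\<And>y. y \<in> lists \<Sigma> \<Longrightarrow> length y + K \<le> length (f y) \<Longrightarrow> length x \<le> length y"
      by (auto simp: P_def)
    obtain n where n: "n \<le> c * length x + c" "state_after M x n \<in> accepting M"
      "output_on_tape (tape_after M x n) (f x)" using run[OF x(1)] by blast
    let ?cs = "\<lambda>p. crossing_states M x p n"
    have distinct: "?cs p \<noteq> ?cs q" if pq: "p < q" "q \<le> length x" for p q
    proof
      assume eq: "?cs p = ?cs q"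
      let ?y = "take p x @ drop q x"
      have y: "?y \<in> lists \<Sigma>" using x(1) by (auto dest: in_set_takeD in_set_dropD)
      obtain k where k: "state_after M ?y k = state_after M x n"
        "tape_after M ?y k = join_halves p q (tape_after M x n) (tape_after M x n)"
        using run_on_cut_input[OF pq eq] by (auto simp: config_after_eq split: if_splits)
      obtain m where m: "state_after M ?y m \<in> accepting M"
        "output_on_tape (tape_after M ?y m) (f ?y)" using run[OF y] by blast
      have "config_after M ?y m = config_after M ?y k"
        using m(1) k(1) n(2) by (intro config_after_halted_unique) (auto simp: halting_def)
      then have out: "output_on_tape (tape_after M ?y k) (f ?y)"
        using m(2) by (simp add: config_after_eq)
      \<comment> \<open>The removed segment lies inside the output, which is at least as long as the input.\<close>
      have q: "q \<le> length (f x)" using pq x(2) by simp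
      have "output_on_tape (tape_after M ?y k) (take p (f x) @ drop q (f x))"
        using n(3) pq q unfolding k(2) output_on_tape_def join_halves_def
        by (auto simp: nth_append Suc_diff_le add.commute)
      then have "length (f ?y) = p + (length (f x) - q)"
        using output_length_unique[OF out] pq q by simp
      then have "length ?y + K \<le> length (f ?y)" using x(2) pq by simp
      from shortest[OF y this] show False using pq by simp
    qed
    have "inj_on ?cs {..length x}"
      by (rule linorder_inj_onI) (use distinct in auto)
    moreover have "(\<Sum>p\<le>length x. length (?cs p)) \<le> c * length x + c"
      using sum_crossing_states_le[of "{..length x}" M x n] n(1) by simp
    ultimately have "length x \<le> N"
      using set_crossing_states[OF M x(1)] by (intro N) auto
    then have "n \<le> c * N + c" using n(1) by (meson add_le_mono1 le_trans mult_le_mono2)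
    moreover have "length (f x) \<le> max (length x) n" using output_length_le[OF n(3)] .
    ultimately show False using x(2) unfolding K_def by linarith
  qed
  then show ?thesis by (meson less_imp_le)
qed

section \<open>Reachability within a time bound\<close>

definition reaches :: "('q, 's, 'x) tm \<Rightarrow> nat \<Rightarrow> ('q, 's, 'x) config \<Rightarrow> ('q, 's, 'x) config \<Rightarrow> bool" where
  "reaches M k c c' \<longleftrightarrow> (\<exists>j\<le>k. (step M ^^ j) c = c')"

lemma reaches_refl: "reaches M k c c"
  unfolding reaches_def by (rule exI[of _ 0]) simp

lemma reaches_trans: "reaches M k c c' \<Longrightarrow> reaches M l c' c'' \<Longrightarrow> reaches M (k + l) c c''"
  unfolding reaches_def
proof (elim exE conjE)
  fix i j assume "i \<le> k" "(step M ^^ i) c = c'" "j \<le> l" "(step M ^^ j) c' = c''"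
  then show "\<exists>j\<le>k + l. (step M ^^ j) c = c''"
    by (intro exI[of _ "j + i"]) (simp add: funpow_add)
qed

lemma reaches_mono: "reaches M k c c' \<Longrightarrow> k \<le> l \<Longrightarrow> reaches M l c c'"
  unfolding reaches_def using le_trans by blast

lemma reaches_step: "step M c = c' \<Longrightarrow> reaches M 1 c c'"
  unfolding reaches_def by (intro exI[of _ 1]) simp

lemma reaches_first: "step M c = c' \<Longrightarrow> reaches M k c' c'' \<Longrightarrow> reaches M (Suc k) c c''"
  using reaches_trans[OF reaches_step] by fastforce

text \<open>
  From here on configurations are compared through \<open>reaches\<close>; the simplifier shall not unfold
  single steps.
\<close>

declare step.simps [simp del]

section \<open>A tape with two tracks\<close>

text \<open>
  \<open>Write us\<close> writes the rest \<open>us\<close> of the initial word on the work track, and \<open>Check us\<close> compares the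
  rest of the work track with \<open>us\<close>. In the other constructors the list consists of the generators
  that still have to be applied before the next input letter is fetched. \<open>Rewind k\<close> moves the head
  back to the end marker and then continues with \<open>k\<close>.
\<close>

datatype ('i, 'q, 's) phase =
    Write "'s list" | Fetch | Simulate 'i 'q "'i list" | Skip "'i list" | Wipe "'i list"
  | Check "'s list" | Accept | Reject | Rewind "('i, 'q, 's) phase"

text \<open>
  \<open>Aux (r, b)\<close> stands for a cell that has been written, with \<open>r\<close> on the input track (the input letter, if it
  has not been read yet) and \<open>b\<close> on the work track. The other cells carry their
  original symbols and count as blank on the work track. So the machine can tell a cell that it
  has never written from one whose work track became blank again, and knows where the used part
  of the tape ends.
\<close>

type_synonym ('a, 's, 'x) track_symbol = "('a, 'a option \<times> ('s, 'x) symbol) symbol"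

fun unread :: "('a, 's, 'x) track_symbol \<Rightarrow> 'a option" where
  "unread (Letter a) = Some a"
| "unread (Aux (r, _)) = r"
| "unread _ = None"

fun work :: "('a, 's, 'x) track_symbol \<Rightarrow> ('s, 'x) symbol" where
  "work End = End"
| "work (Aux (_, b)) = b"
| "work _ = Blank"

definition put :: "('a, 's, 'x) track_symbol \<Rightarrow> ('s, 'x) symbol \<Rightarrow> ('a, 's, 'x) track_symbol" where
  "put y b = (if y = End then End else Aux (unread y, b))"

text \<open>
  \<open>H\<close> is the last cell of the used part, which covers the input and all written cells, \<open>I\<close> the content of the input track and \<open>W\<close> that of the work track.
\<close>

definition tracks :: "nat \<Rightarrow> (nat \<Rightarrow> 'a option) \<Rightarrow> (nat \<Rightarrow> ('s, 'x) symbol) \<Rightarrow>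
    (nat \<Rightarrow> ('a, 's, 'x) track_symbol) \<Rightarrow> bool" where
  "tracks H I W t \<longleftrightarrow> (\<forall>i. t i = End \<longleftrightarrow> i = 0) \<and> (\<forall>i. t i = Blank \<longleftrightarrow> H < i) \<and>
     (\<forall>i. unread (t i) = I i) \<and> (\<forall>i. work (t i) = W i)"

lemma tracksD:
  assumes "tracks H I W t"
  shows "t i = End \<longleftrightarrow> i = 0" "t i = Blank \<longleftrightarrow> H < i" "unread (t i) = I i" "work (t i) = W i"
  using assms by (simp_all add: tracks_def)

lemma tracks_beyond:
  assumes "tracks H I W t" "H < i"
  shows "t i = Blank" "I i = None" "W i = Blank"
  using assms tracksD[OF assms(1), of i] by auto

lemma tracks_put:
  fixes t :: "nat \<Rightarrow> ('a, 's, 'x) track_symbol"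
  assumes "tracks H I W t" "h \<le> H + 1" "b = End \<longleftrightarrow> h = 0"
  shows "tracks (max H h) I (W(h := b)) (t(h := put (t h) b))"
proof -
  have "unread (put y b) = unread y" "work (put y b) = b" "put y b = End \<longleftrightarrow> y = End" "put y b \<noteq> Blank"
    if "b = End \<longleftrightarrow> y = End" for y :: "('a, 's, 'x) track_symbol" and b
    using that by (auto simp: put_def)
  note put = this[of b "t h"]
  have "t h = End \<longleftrightarrow> h = 0" "t h = Blank \<longleftrightarrow> H < h" "unread (t h) = I h"
    using tracksD[OF assms(1)] by simp_all
  then show ?thesis using assms put by (auto simp: tracks_def)
qed

lemma tracks_input_tape:
  "tracks (length v) (\<lambda>i. if 0 < i \<and> i \<le> length v then Some (v ! (i - 1)) else None)
     (input_tape []) (input_tape v :: nat \<Rightarrow> ('a, 's, 'x) track_symbol)"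
  unfolding tracks_def
proof (intro conjI allI)
  fix i
  let ?t = "input_tape v :: nat \<Rightarrow> ('a, 's, 'x) track_symbol"
  show "?t i = End \<longleftrightarrow> i = 0" by (rule input_tape_0_iff)
  show "?t i = Blank \<longleftrightarrow> length v < i" by (cases i) auto
  show "unread (?t i) = (if 0 < i \<and> i \<le> length v then Some (v ! (i - 1)) else None)" by (cases i) auto
  show "work (?t i) = input_tape [] i" by (cases i) auto
qed

section \<open>The machine that applies the functions letter by letter\<close>

text \<open>
  Each letter \<open>a\<close> of the input alphabet \<open>\<Gamma>\<close> stands for a list \<open>expand a\<close> of indices, and index \<open>i\<close>
  for a function \<open>f i\<close> on words over \<open>\<Sigma>\<close>, computed by the machine \<open>M i\<close> in linear time. The machine
  constructed below applies all these functions, in the order of the input, to the word \<open>e\<close> and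
  decides whether the result is \<open>e\<close> again.
\<close>

locale iterated_application =
  fixes \<Gamma> :: "'a set" and expand :: "'a \<Rightarrow> 'i list"
    and \<Sigma> :: "'s set" and e :: "'s list"
    and S :: "'i set" and M :: "'i \<Rightarrow> ('q, 's, 'x) tm" and f :: "'i \<Rightarrow> 's list \<Rightarrow> 's list"
    and c K :: nat
  assumes finite_parameters: "finite \<Gamma>" "finite \<Sigma>" "finite S"
    and expand: "\<And>a. a \<in> \<Gamma> \<Longrightarrow> expand a \<in> lists S"
    and e: "e \<in> lists \<Sigma>"
    and M: "\<And>i. i \<in> S \<Longrightarrow> tm_over \<Sigma> (M i)"
    and f_closed: "\<And>i x. i \<in> S \<Longrightarrow> x \<in> lists \<Sigma> \<Longrightarrow> f i x \<in> lists \<Sigma>"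
    and f_length: "\<And>i x. i \<in> S \<Longrightarrow> x \<in> lists \<Sigma> \<Longrightarrow> length (f i x) \<le> length x + K"
    and computes: "\<And>i x. i \<in> S \<Longrightarrow> x \<in> lists \<Sigma> \<Longrightarrow> \<exists>n \<le> c * length x + c.
      state_after (M i) x n \<in> accepting (M i) \<and> output_on_tape (tape_after (M i) x n) (f i x)"
begin

fun next_phase :: "'i list \<Rightarrow> ('i, 'q, 's) phase" where
  "next_phase [] = Fetch"
| "next_phase (i # is) = Simulate i (initial (M i)) is"

text \<open>
  After a machine \<open>M i\<close> has halted, its output ends at the first blank of the work track, and
  anything may follow. The next machine expects blanks there, so \<open>Skip\<close> walks to this first blank
  and \<open>Wipe\<close> clears the work track from it up to the end of the used part. \<open>Fetch\<close> looks for the first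
  unread letter; if it reaches a blank that was never written instead, the whole input has been read.

  \<open>Simulate\<close> rejects symbols outside the tape alphabet of \<open>M i\<close>. The machines share the work
  track but not their alphabets, and \<open>M i\<close> is under no obligation on foreign symbols; the rejection
  keeps the transitions closed and never happens in a computation.
\<close>

fun delta :: "('i, 'q, 's) phase \<Rightarrow> ('a, 's, 'x) track_symbol \<Rightarrow>
    ('i, 'q, 's) phase \<times> ('a, 's, 'x) track_symbol \<times> direction" where
  "delta (Write us) y =
     (if y = End then (Write us, y, Move_Right)
      else case us of [] \<Rightarrow> (Rewind Fetch, y, Stay)
        | u # us' \<Rightarrow> (Write us', put y (Letter u), Move_Right))"
| "delta Fetch y =
     (if y = Blank then (Rewind (Check e), y, Stay)
      else case unread y of None \<Rightarrow> (Fetch, y, Move_Right)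
        | Some a \<Rightarrow> (Rewind (next_phase (expand a)), Aux (None, work y), Stay))"
| "delta (Simulate i q is) y =
     (if q \<in> halting (M i) then (Rewind (Skip is), y, Stay)
      else if work y \<in> tape_alphabet (M i)
      then (case trans (M i) q (work y) of (q', b, d) \<Rightarrow> (Simulate i q' is, put y b, d))
      else (Reject, y, Stay))"
| "delta (Skip is) y =
     (if work y = Blank then (Wipe is, y, Stay) else (Skip is, y, Move_Right))"
| "delta (Wipe is) y =
     (if y = Blank then (Rewind (next_phase is), y, Stay) else (Wipe is, put y Blank, Move_Right))"
| "delta (Check us) y =
     (if y = End then (Check us, y, Move_Right)
      else case us of [] \<Rightarrow> (if work y = Blank then Accept else Reject, y, Stay)
        | u # us' \<Rightarrow> if work y = Letter u then (Check us', y, Move_Right) else (Reject, y, Stay))"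
| "delta (Rewind k) y = (if y = End then (k, y, Stay) else (Rewind k, y, Move_Left))"
| "delta Accept y = (Accept, y, Stay)"
| "delta Reject y = (Reject, y, Stay)"

definition short_words :: "'s list set" where
  "short_words = {us. set us \<subseteq> \<Sigma> \<and> length us \<le> length e}"

definition max_expansion :: nat where
  "max_expansion = (\<Sum>a\<in>\<Gamma>. length (expand a))"

text \<open>
  The possible remainders of an expansion; all that matters is that there are finitely many and
  that the tail of such a list is again one.
\<close>

definition jobs :: "'i list set" where
  "jobs = {is. set is \<subseteq> S \<and> length is \<le> max_expansion}"

definition forward_phases :: "('i, 'q, 's) phase set" where
  "forward_phases = {Fetch, Accept, Reject} \<union> Write ` short_words \<union> Check ` short_words \<union>
     Skip ` jobs \<union> Wipe ` jobs \<union> (\<Union>i\<in>S. \<Union>q\<in>states (M i). Simulate i q ` jobs)"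

definition work_symbols :: "('s, 'x) symbol set" where
  "work_symbols = {Blank} \<union> Letter ` \<Sigma> \<union> (\<Union>i\<in>S. tape_alphabet (M i))"

definition simulator :: "(('i, 'q, 's) phase, 'a, 'a option \<times> ('s, 'x) symbol) tm" where
  "simulator = \<lparr> states = forward_phases \<union> Rewind ` forward_phases,
     tape_alphabet = {End, Blank} \<union> Letter ` \<Gamma> \<union> Aux ` (insert None (Some ` \<Gamma>) \<times> work_symbols),
     initial = Write e, accepting = {Accept}, rejecting = {Reject}, trans = delta \<rparr>"

lemma halting_simulator: "halting simulator = {Accept, Reject}"
  by (auto simp: halting_def simulator_def)

section \<open>Well-formedness of the machine\<close>

lemma initial_simulator: "initial simulator = Write e"
  by (simp add: simulator_def)

lemma length_expand_le: "a \<in> \<Gamma> \<Longrightarrow> length (expand a) \<le> max_expansion"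
  unfolding max_expansion_def using finite_parameters by (intro member_le_sum) auto

lemma next_phase_forward: "is \<in> jobs \<Longrightarrow> next_phase is \<in> forward_phases"
proof (cases "is")
  case (Cons i is')
  assume "is \<in> jobs"
  then have "i \<in> S" "is' \<in> jobs" by (auto simp: jobs_def Cons)
  moreover from this M[of i] have "initial (M i) \<in> states (M i)" by (simp add: tm_over_def)
  ultimately show ?thesis unfolding Cons forward_phases_def next_phase.simps by blast
qed (simp add: forward_phases_def)

lemma expand_jobs: "a \<in> \<Gamma> \<Longrightarrow> expand a \<in> jobs"
  using expand length_expand_le by (auto simp: jobs_def)

lemma tape_alphabet_simulator:
  "y \<in> tape_alphabet simulator \<Longrightarrow> y \<noteq> End \<Longrightarrow> b \<in> work_symbols \<Longrightarrow>
    put y b \<in> tape_alphabet simulator"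
  by (auto simp: simulator_def put_def)

lemma unread_alphabet: "y \<in> tape_alphabet simulator \<Longrightarrow> unread y = Some a \<Longrightarrow> a \<in> \<Gamma>"
  by (auto simp: simulator_def)

lemma work_alphabet: "y \<in> tape_alphabet simulator \<Longrightarrow> y \<noteq> End \<Longrightarrow> work y \<in> work_symbols"
  by (auto simp: simulator_def work_symbols_def)

lemma delta_within:
  assumes q: "q \<in> states simulator" "q \<notin> halting simulator" and y: "y \<in> tape_alphabet simulator"
    and d: "delta q y = (q', b, d)"
  shows "q' \<in> states simulator \<and> b \<in> tape_alphabet simulator \<and> (b = End \<longleftrightarrow> y = End) \<and> (y = End \<longrightarrow> d \<noteq> Move_Left)"
proof -
  have st: "states simulator = forward_phases \<union> Rewind ` forward_phases" by (simp add: simulator_def)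
  have put_End: "put y b = End \<longleftrightarrow> y = End" for b by (simp add: put_def)
  have B: "Blank \<in> work_symbols" "\<And>u. u \<in> \<Sigma> \<Longrightarrow> Letter u \<in> work_symbols"
    by (auto simp: work_symbols_def)
  have End: "End \<in> tape_alphabet simulator" by (simp add: simulator_def)
  have put: "b \<in> work_symbols \<Longrightarrow> put y b \<in> tape_alphabet simulator" for b
    using tape_alphabet_simulator[OF y] End by (cases "y = End") (auto simp: put_def)
  show ?thesis
  proof (cases q)
    case (Write us)
    then have "us \<in> short_words" using q by (auto simp: st forward_phases_def)
    then show ?thesis using Write d y put put_End B
      by (auto simp: st forward_phases_def short_words_def split: if_splits list.splits)
  next
    case Fetch
    have "e \<in> short_words" using e by (auto simp: short_words_def)
    then have C: "Check e \<in> forward_phases" by (auto simp: forward_phases_def)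
    have F: "Fetch \<in> forward_phases" by (auto simp: forward_phases_def)
    have X: "next_phase (expand a) \<in> forward_phases \<and> y \<noteq> End \<and>
       Aux (None, work y) \<in> tape_alphabet simulator" if r: "unread y = Some a" for a
    proof -
      from r have "y \<noteq> End" by auto
      then show ?thesis
        using unread_alphabet[OF y r] work_alphabet[OF y] next_phase_forward[OF expand_jobs] by (simp add: simulator_def)
    qed
    show ?thesis using Fetch d y C F X
      by (auto simp: st split: if_splits option.splits)
  next
    case (Simulate i p "is")
    then have i: "i \<in> S" "p \<in> states (M i)" "is \<in> jobs" using q by (auto simp: st forward_phases_def)
    have tm: "tm_over \<Sigma> (M i)" using M i by simp
    show ?thesis
    proof (cases "p \<in> halting (M i) \<or> work y \<notin> tape_alphabet (M i)")
      case True
      then show ?thesis using d y i Simulate by (auto simp: st forward_phases_def split: if_splits)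
    next
      case False
      obtain p' b' d' where tr: "trans (M i) p (work y) = (p', b', d')" by (metis prod_cases3)
      have "p' \<in> states (M i) \<and> b' \<in> tape_alphabet (M i) \<and> (work y = End \<longrightarrow> d' \<noteq> Move_Left)"
        using tm tr False i unfolding tm_over_def by (metis DiffI)
      moreover have "q' = Simulate i p' is" "b = put y b'" "d = d'" using d Simulate False tr by auto
      ultimately show ?thesis using i put put_End
        by (auto simp: st forward_phases_def work_symbols_def)
    qed
  next
    case (Skip "is")
    then show ?thesis using q d y by (auto simp: st forward_phases_def split: if_splits)
  next
    case (Wipe "is")
    then have "is \<in> jobs" using q by (auto simp: st forward_phases_def)
    then show ?thesis using q d y Wipe put put_End B next_phase_forward[of "is"]
      by (auto simp: st split: if_splits) 
  next
    case (Check us)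
    then have "us \<in> short_words" using q by (auto simp: st forward_phases_def)
    then show ?thesis using Check d y
      by (auto simp: st forward_phases_def short_words_def split: if_splits list.splits)
  next
    case (Rewind k)
    have "Rewind k \<notin> forward_phases" by (auto simp: forward_phases_def)
    with Rewind q have "k \<in> forward_phases" by (auto simp: st)
    then show ?thesis using Rewind d y by (auto simp: st split: if_splits)
  qed (use q in \<open>auto simp: halting_simulator\<close>)
qed

lemma tm_over_simulator: "tm_over \<Gamma> simulator"
proof -
  have fin: "finite short_words" "finite jobs"
    unfolding short_words_def jobs_def using finite_parameters by (auto intro: finite_lists_length_le)
  have "finite forward_phases"
    unfolding forward_phases_def using fin finite_parameters M by (auto simp: tm_over_def)
  then have "finite (states simulator)" by (simp add: simulator_def)
  moreover have "finite work_symbols" unfolding work_symbols_def using finite_parameters M by (auto simp: tm_over_def)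
  then have "finite (tape_alphabet simulator)" using finite_parameters by (simp add: simulator_def)
  moreover have "initial simulator \<in> states simulator" using e by (auto simp: simulator_def forward_phases_def short_words_def)
  moreover have "accepting simulator \<subseteq> states simulator" "rejecting simulator \<subseteq> states simulator" by (auto simp: simulator_def forward_phases_def)
  moreover have "trans simulator = delta" "accepting simulator \<inter> rejecting simulator = {}"
    "{End, Blank} \<union> Letter ` \<Gamma> \<subseteq> tape_alphabet simulator" by (auto simp: simulator_def)
  moreover have "\<forall>q\<in>states simulator - halting simulator. \<forall>y\<in>tape_alphabet simulator. \<forall>q' b d. trans simulator q y = (q', b, d) \<longrightarrow>
      q' \<in> states simulator \<and> b \<in> tape_alphabet simulator \<and> (b = End \<longleftrightarrow> y = End) \<and> (y = End \<longrightarrow> d \<noteq> Move_Left)"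
    unfolding \<open>trans simulator = delta\<close> by (intro ballI allI impI delta_within) auto
  ultimately show ?thesis unfolding tm_over_def by (intro conjI)
qed

section \<open>The phases of a computation\<close>

lemma step_simulator:
  "delta q (t h) = (q', b, d) \<Longrightarrow> q \<noteq> Accept \<Longrightarrow> q \<noteq> Reject \<Longrightarrow>
    step simulator (q, h, t) = (q', move d h, t(h := b))"
  by (simp add: step.simps halting_simulator) (simp add: simulator_def)

lemma reaches_simulator:
  "delta q (t h) = (q', b, d) \<Longrightarrow> q \<noteq> Accept \<Longrightarrow> q \<noteq> Reject \<Longrightarrow>
    reaches simulator 1 (q, h, t) (q', move d h, t(h := b))"
  by (intro reaches_step step_simulator)

lemma reaches_scan:
  assumes "\<And>j. j < m \<Longrightarrow> delta q (t (h + j)) = (q, t (h + j), Move_Right)" "q \<noteq> Accept" "q \<noteq> Reject"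
  shows "reaches simulator m (q, h, t) (q, h + m, t)"
  using assms(1)
proof (induction m)
  case (Suc m)
  then have "reaches simulator m (q, h, t) (q, h + m, t)" by simp
  moreover have "reaches simulator 1 (q, h + m, t) (q, h + Suc m, t)"
    using reaches_simulator[of q t "h + m"] Suc.prems[of m] assms(2,3) by simp
  ultimately show ?case using reaches_trans by fastforce
qed (simp add: reaches_refl)

lemma reaches_rewind:
  assumes "tracks H I W t"
  shows "reaches simulator (h + 1) (Rewind k, h, t) (k, 0, t)"
proof (induction h)
  case 0
  have "delta (Rewind k) (t 0) = (k, t 0, Stay)" using tracksD(1)[OF assms, of 0] by simp
  from reaches_simulator[of _ t "0", OF this] show ?case by simp
next
  case (Suc h)
  have "delta (Rewind k) (t (Suc h)) = (Rewind k, t (Suc h), Move_Left)"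
    using tracksD(1)[OF assms, of "Suc h"] by simp
  from step_simulator[of _ t "(Suc h)", OF this] show ?case using reaches_first[OF _ Suc] by simp
qed

text \<open>
  Positions on the work track agree with positions on the tape, so one step of \<open>M i\<close> is one step
  here. The head visits at most one new cell at a time, which keeps the used part contiguous.
\<close>

lemma reaches_simulate:
  assumes i: "i \<in> S" and w: "w \<in> lists \<Sigma>" and t: "tracks H I (input_tape w) t"
  shows "\<exists>H' t'. H' \<le> max H n \<and> head_after (M i) w n \<le> H' + 1 \<and>
    tracks H' I (tape_after (M i) w n) t' \<and>
    reaches simulator n (Simulate i (initial (M i)) is, 0, t)
      (Simulate i (state_after (M i) w n) is, head_after (M i) w n, t')"
proof (induction n)
  case 0
  then show ?case using t by (auto intro!: exI[of _ H] exI[of _ t] reaches_refl)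
next
  case (Suc n)
  let ?q = "state_after (M i) w n" and ?h = "head_after (M i) w n" and ?T = "tape_after (M i) w n"
  from Suc obtain H' t' where IH: "H' \<le> max H n" "?h \<le> H' + 1" "tracks H' I ?T t'"
    "reaches simulator n (Simulate i (initial (M i)) is, 0, t) (Simulate i ?q is, ?h, t')" by blast
  have within: "?q \<in> states (M i)" "?T ?h \<in> tape_alphabet (M i)" "?T ?h = End \<longleftrightarrow> ?h = 0"
    using run_within_machine[OF M[OF i] w, of n] by auto
  show ?case
  proof (cases rule: step_after_cases[of "M i" w n])
    case halted
    then show ?thesis using IH by (auto intro!: exI[of _ H'] exI[of _ t'] intro: reaches_mono)
  next
    case (moved q b d)
    have "b = End \<longleftrightarrow> ?h = 0"
      using within(3) M[OF i] moved(1,2) within unfolding tm_over_def by (metis DiffI)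
    then have tr: "tracks (max H' ?h) I (?T(?h := b)) (t'(?h := put (t' ?h) b))"
      by (rule tracks_put[OF IH(3,2)])
    have "delta (Simulate i ?q is) (t' ?h) = (Simulate i q is, put (t' ?h) b, d)"
      using moved within tracksD(4)[OF IH(3)] by simp
    then have "reaches simulator 1 (Simulate i ?q is, ?h, t') (Simulate i q is, move d ?h, t'(?h := put (t' ?h) b))"
      by (rule reaches_simulator) auto
    from reaches_trans[OF IH(4) this]
    have "reaches simulator (Suc n) (Simulate i (initial (M i)) is, 0, t)
      (Simulate i q is, move d ?h, t'(?h := put (t' ?h) b))" by simp
    moreover have "max H' ?h \<le> max H (Suc n)" using IH(1) head_after_le[of "M i" w n] by auto
    moreover have "move d ?h \<le> max H' ?h + 1" by (cases d) auto
    ultimately show ?thesis using tr moved(3-5) by metis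
  qed
qed

lemma reaches_wipe:
  assumes "tracks H I W t" "0 < h" "h \<le> H + 1"
  shows "\<exists>t'. tracks H I (\<lambda>i. if i < h then W i else Blank) t' \<and>
    reaches simulator (H + 2 - h) (Wipe is, h, t) (Rewind (next_phase is), H + 1, t')"
  using assms
proof (induction "H + 1 - h" arbitrary: h t W)
  case 0
  then have h: "h = H + 1" by simp
  have "W = (\<lambda>i. if i < h then W i else Blank)"
    using tracks_beyond(3)[OF 0(2)] h by (auto simp: fun_eq_iff)
  moreover have "delta (Wipe is) (t h) = (Rewind (next_phase is), t h, Stay)"
    using tracksD(2)[OF 0(2), of h] h by simp
  from reaches_simulator[of _ t "h", OF this] have "reaches simulator 1 (Wipe is, h, t) (Rewind (next_phase is), H + 1, t)"
    using h by simp
  ultimately show ?case using 0(2) h by auto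
next
  case (Suc m)
  let ?t = "t(h := put (t h) Blank)"
  have "delta (Wipe is) (t h) = (Wipe is, put (t h) Blank, Move_Right)"
    using tracksD(2)[OF Suc(3), of h] Suc(2) by simp
  from step_simulator[of _ t "h", OF this] have st: "step simulator (Wipe is, h, t) = (Wipe is, h + 1, ?t)" by simp
  have "tracks (max H h) I (W(h := Blank)) ?t" using Suc by (intro tracks_put) auto
  moreover have "max H h = H" using Suc(2) by simp
  ultimately have "tracks H I (W(h := Blank)) ?t" by simp
  have "\<exists>t'. tracks H I (\<lambda>i. if i < h + 1 then (W(h := Blank)) i else Blank) t' \<and>
      reaches simulator (H + 2 - (h + 1)) (Wipe is, h + 1, ?t) (Rewind (next_phase is), H + 1, t')"
    by (rule Suc(1)[OF _ \<open>tracks H I (W(h := Blank)) ?t\<close>]) (use Suc(2) in simp_all)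
  then obtain t' where
    t': "tracks H I (\<lambda>i. if i < h + 1 then (W(h := Blank)) i else Blank) t'"
    "reaches simulator (H + 2 - (h + 1)) (Wipe is, h + 1, ?t) (Rewind (next_phase is), H + 1, t')"
    by blast
  have "(\<lambda>i. if i < h + 1 then (W(h := Blank)) i else Blank) = (\<lambda>i. if i < h then W i else Blank)"
    by (auto simp: fun_eq_iff)
  moreover have "reaches simulator (Suc (H + 2 - (h + 1))) (Wipe is, h, t) (Rewind (next_phase is), H + 1, t')"
    using reaches_first[OF st t'(2)] .
  moreover have "Suc (H + 2 - (h + 1)) = H + 2 - h" using Suc(2) by simp
  ultimately show ?case using t'(1) by auto
qed

text \<open>
  The phases of one application: simulate, rewind, skip the output, wipe what follows it, rewind.
  Each takes time \<open>O(B)\<close>, as \<open>B\<close> bounds both the used part and the running time of \<open>M i\<close>.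
\<close>

lemma reaches_apply:
  assumes i: "i \<in> S" and w: "w \<in> lists \<Sigma>" and t: "tracks H I (input_tape w) t"
    and B: "H \<le> B" "c * length w + c \<le> B"
  shows "\<exists>H' t'. H' \<le> B \<and> tracks H' I (input_tape (f i w)) t' \<and>
    reaches simulator (5 * B + 8) (Simulate i (initial (M i)) is, 0, t) (next_phase is, 0, t')"
proof -
  obtain n where n: "n \<le> c * length w + c" "state_after (M i) w n \<in> accepting (M i)"
    and out: "output_on_tape (tape_after (M i) w n) (f i w)" using computes[OF i w] by blast
  let ?q = "state_after (M i) w n" and ?h = "head_after (M i) w n" and ?T = "tape_after (M i) w n"
  let ?u = "f i w"
  obtain H' t' where sim: "H' \<le> max H n" "?h \<le> H' + 1" "tracks H' I ?T t'"
    "reaches simulator n (Simulate i (initial (M i)) is, 0, t) (Simulate i ?q is, ?h, t')"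
    using reaches_simulate[OF i w t, of n] by blast
  have H': "H' \<le> B" using sim(1) B n(1) by simp
  have "delta (Simulate i ?q is) (t' ?h) = (Rewind (Skip is), t' ?h, Stay)"
    using n(2) by (simp add: halting_def)
  from reaches_simulator[of _ t' "?h", OF this] have "reaches simulator 1 (Simulate i ?q is, ?h, t') (Rewind (Skip is), ?h, t')" by simp
  note run = reaches_trans[OF reaches_trans[OF sim(4) this] reaches_rewind[OF sim(3)]]
  have nonblank: "?T j \<noteq> Blank" if "j \<le> length ?u" for j
    using out that by (cases j) (auto simp: output_on_tape_def)
  have blank: "?T (Suc (length ?u)) = Blank" using out by (simp add: output_on_tape_def)
  have le: "length ?u \<le> H'"
    using nonblank[of "length ?u"] tracks_beyond(3)[OF sim(3), of "length ?u"] by (meson le_refl not_le)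
  have "reaches simulator (Suc (length ?u)) (Skip is, 0, t') (Skip is, 0 + Suc (length ?u), t')"
    by (rule reaches_scan) (use nonblank tracksD(4)[OF sim(3)] in auto)
  note run = reaches_trans[OF run this]
  have "delta (Skip is) (t' (Suc (length ?u))) = (Wipe is, t' (Suc (length ?u)), Stay)"
    using blank tracksD(4)[OF sim(3)] by simp
  from reaches_simulator[of _ t' "(Suc (length ?u))", OF this]
  have "reaches simulator 1 (Skip is, 0 + Suc (length ?u), t') (Wipe is, Suc (length ?u), t')" by simp
  note run = reaches_trans[OF run this]
  obtain t'' where t'': "tracks H' I (\<lambda>j. if j < Suc (length ?u) then ?T j else Blank) t''"
    "reaches simulator (H' + 2 - Suc (length ?u)) (Wipe is, Suc (length ?u), t') (Rewind (next_phase is), H' + 1, t'')"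
    using reaches_wipe[OF sim(3), of "Suc (length ?u)"] le by auto
  note run = reaches_trans[OF reaches_trans[OF run t''(2)] reaches_rewind[OF t''(1)]]
  have "(\<lambda>j. if j < Suc (length ?u) then ?T j else Blank) = input_tape ?u"
  proof
    fix j show "(if j < Suc (length ?u) then ?T j else Blank) = input_tape ?u j"
      using out by (cases j) (auto simp: output_on_tape_def)
  qed
  with t''(1) have "tracks H' I (input_tape ?u) t''" by simp
  moreover have "n + 1 + (?h + 1) + Suc (length ?u) + 1 + (H' + 2 - Suc (length ?u)) + (H' + 1 + 1) \<le> 5 * B + 8"
    using le H' sim(2) n(1) B by simp
  ultimately show ?thesis using reaches_mono[OF run] H' by blast
qed

lemma fold_f_closed: "is \<in> lists S \<Longrightarrow> w \<in> lists \<Sigma> \<Longrightarrow> fold f is w \<in> lists \<Sigma>"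
  by (induction "is" arbitrary: w) (simp_all add: f_closed del: in_lists_conv_set)

lemma fold_f_length:
  "is \<in> lists S \<Longrightarrow> w \<in> lists \<Sigma> \<Longrightarrow> length (fold f is w) \<le> length w + K * length is"
proof (induction "is" arbitrary: w)
  case (Cons i "is")
  then have "length (fold f is (f i w)) \<le> length (f i w) + K * length is" using f_closed by simp
  then show ?case using f_length[of i w] Cons by simp
qed simp

text \<open>
  The bound \<open>B\<close> is fixed beforehand and must suffice for the longest word that occurs on the way;
  this is where the bounded growth of the functions enters.
\<close>

lemma reaches_fold:
  assumes "is \<in> lists S" "w \<in> lists \<Sigma>" "tracks H I (input_tape w) t"
    and "H \<le> B" "c * (length w + K * length is) + c \<le> B"
  shows "\<exists>H' t'. H' \<le> B \<and> tracks H' I (input_tape (fold f is w)) t' \<and>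
    reaches simulator (length is * (5 * B + 8)) (next_phase is, 0, t) (Fetch, 0, t')"
  using assms
proof (induction "is" arbitrary: w H t rule: list.induct)
  case Nil
  then show ?case by (auto intro: reaches_refl)
next
  case (Cons i "is")
  have i: "i \<in> S" "is \<in> lists S" using Cons.prems(1) by simp_all
  have "c * length w + c \<le> c * (length w + K * length (i # is)) + c" by simp
  then have "c * length w + c \<le> B" using Cons.prems by linarith
  then obtain H1 t1 where 1: "H1 \<le> B" "tracks H1 I (input_tape (f i w)) t1"
    "reaches simulator (5 * B + 8) (Simulate i (initial (M i)) is, 0, t) (next_phase is, 0, t1)"
    using reaches_apply[OF i(1) Cons.prems(2-4)] by blast
  have "length (f i w) + K * length is \<le> length w + K * length (i # is)"
    using f_length[OF i(1) Cons.prems(2)] by simp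
  then have "c * (length (f i w) + K * length is) + c \<le> B"
    using Cons.prems(5) by (meson add_le_mono1 le_trans mult_le_mono2)
  from Cons.IH[OF i(2) f_closed[OF i(1) Cons.prems(2)] 1(2,1) this]
  obtain H' t' where 2: "H' \<le> B" "tracks H' I (input_tape (fold f is (f i w))) t'"
    "reaches simulator (length is * (5 * B + 8)) (next_phase is, 0, t1) (Fetch, 0, t')" by blast
  from reaches_trans[OF 1(3) 2(3)] 2(1,2) show ?case by auto
qed

lemma reaches_fetch:
  assumes t: "tracks H I W t" and p: "I p = Some a" "\<And>i. i < p \<Longrightarrow> I i = None" and B: "H \<le> B"
  shows "\<exists>t'. tracks H (I(p := None)) W t' \<and>
    reaches simulator (2 * B + 2) (Fetch, 0, t) (next_phase (expand a), 0, t')"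
proof -
  have pH: "p \<le> H" using p(1) tracks_beyond(2)[OF t, of p] by (cases "p \<le> H") auto
  have p0: "p \<noteq> 0"
  proof
    assume "p = 0"
    then have "t p = End" "unread (t p) = Some a" using p(1) tracksD(1,3)[OF t, of p] by simp_all
    then show False by simp
  qed
  let ?t = "t(p := Aux (None, work (t p)))"
  have "reaches simulator p (Fetch, 0, t) (Fetch, 0 + p, t)"
    by (rule reaches_scan) (use p(2) pH tracksD(2,3)[OF t] in auto)
  moreover have "delta Fetch (t p) = (Rewind (next_phase (expand a)), Aux (None, work (t p)), Stay)"
    using p(1) pH tracksD(2,3)[OF t] by simp
  from reaches_simulator[of _ t "p", OF this] have "reaches simulator 1 (Fetch, 0 + p, t) (Rewind (next_phase (expand a)), p, ?t)"
    by simp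
  ultimately have run: "reaches simulator (p + 1) (Fetch, 0, t) (Rewind (next_phase (expand a)), p, ?t)"
    by (rule reaches_trans)
  have tr: "tracks H (I(p := None)) W ?t" using t p0 pH by (auto simp: tracks_def)
  have "reaches simulator (2 * B + 2) (Fetch, 0, t) (next_phase (expand a), 0, ?t)"
    by (rule reaches_mono[OF reaches_trans[OF run reaches_rewind[OF tr]]]) (use pH B in simp)
  then show ?thesis using tr by blast
qed

lemma reaches_check_phase:
  assumes t: "tracks H I W t" and I: "\<And>i. I i = None" and B: "H \<le> B"
  shows "reaches simulator (2 * B + 4) (Fetch, 0, t) (Check e, 0, t)"
proof -
  have "reaches simulator (H + 1) (Fetch, 0, t) (Fetch, 0 + (H + 1), t)"
    by (rule reaches_scan) (use I tracksD(2,3)[OF t] in auto)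
  moreover have "delta Fetch (t (H + 1)) = (Rewind (Check e), t (H + 1), Stay)"
    using tracksD(2)[OF t] by simp
  from reaches_simulator[of _ t "(H + 1)", OF this] have "reaches simulator 1 (Fetch, 0 + (H + 1), t) (Rewind (Check e), H + 1, t)" by simp
  ultimately have "reaches simulator (H + 1 + 1) (Fetch, 0, t) (Rewind (Check e), H + 1, t)"
    by (rule reaches_trans)
  from reaches_trans[OF this reaches_rewind[OF t]] show ?thesis
    by (rule reaches_mono) (use B in simp)
qed

lemma reaches_verdict:
  assumes t: "tracks H I (input_tape w) t" and "k \<le> length w"
  shows "\<exists>h. reaches simulator (length us + 1) (Check us, Suc k, t) (if us = drop k w then Accept else Reject, h, t)"
  using assms(2)
proof (induction us arbitrary: k)
  case Nil
  have "delta (Check []) (t (Suc k)) = (if [] = drop k w then Accept else Reject, t (Suc k), Stay)"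
    using tracksD(1,4)[OF t, of "Suc k"] Nil by (auto split: if_splits)
  from reaches_simulator[of _ t "(Suc k)", OF this] show ?case by auto
next
  case (Cons u us)
  show ?case
  proof (cases "k < length w \<and> w ! k = u")
    case True
    then have "delta (Check (u # us)) (t (Suc k)) = (Check us, t (Suc k), Move_Right)"
      using tracksD(1,4)[OF t, of "Suc k"] by auto
    from step_simulator[of _ t "(Suc k)", OF this] have st: "step simulator (Check (u # us), Suc k, t) = (Check us, Suc (Suc k), t)" by simp
    from True obtain h where "reaches simulator (length us + 1) (Check us, Suc (Suc k), t)
        (if us = drop (Suc k) w then Accept else Reject, h, t)" using Cons.IH[of "Suc k"] by auto
    from reaches_first[OF st this] True show ?thesis by (auto simp: Cons_nth_drop_Suc[symmetric])
  next
    case False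
    then have "work (t (Suc k)) \<noteq> Letter u" using tracksD(4)[OF t, of "Suc k"] by auto
    then have "delta (Check (u # us)) (t (Suc k)) = (Reject, t (Suc k), Stay)"
      using tracksD(1)[OF t, of "Suc k"] by simp
    from reaches_simulator[of _ t "(Suc k)", OF this] have "reaches simulator 1 (Check (u # us), Suc k, t) (Reject, Suc k, t)" by simp
    moreover have "u # us \<noteq> drop k w"
      using False Cons.prems by (cases "k < length w") (auto simp: Cons_nth_drop_Suc[symmetric])
    ultimately show ?thesis by (auto intro: reaches_mono)
  qed
qed

lemma reaches_write:
  assumes "tracks H I W t" "k \<le> H" "\<And>i. k < i \<Longrightarrow> W i = Blank"
  shows "\<exists>t'. tracks (max H (k + length us)) I (\<lambda>i. if i \<le> k then W i else input_tape us (i - k)) t' \<and>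
    reaches simulator (length us + 1) (Write us, Suc k, t) (Rewind Fetch, Suc (k + length us), t')"
  using assms
proof (induction us arbitrary: H W t k)
  case Nil
  have "delta (Write []) (t (Suc k)) = (Rewind Fetch, t (Suc k), Stay)"
    using tracksD(1)[OF Nil(1), of "Suc k"] by simp
  from reaches_simulator[of _ t "(Suc k)", OF this] have "reaches simulator 1 (Write [], Suc k, t) (Rewind Fetch, Suc k, t)" by simp
  moreover have "(\<lambda>i. if i \<le> k then W i else input_tape [] (i - k)) = W"
    using Nil(3) by (auto simp: fun_eq_iff input_tape_beyond)
  ultimately show ?case using Nil by (auto simp: max_def)
next
  case (Cons u us)
  let ?t = "t(Suc k := put (t (Suc k)) (Letter u))" and ?W = "W(Suc k := Letter u)"
  have "delta (Write (u # us)) (t (Suc k)) = (Write us, put (t (Suc k)) (Letter u), Move_Right)"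
    using tracksD(1)[OF Cons(2), of "Suc k"] by simp
  from step_simulator[of _ t "(Suc k)", OF this] have st: "step simulator (Write (u # us), Suc k, t) = (Write us, Suc (Suc k), ?t)" by simp
  have tr: "tracks (max H (Suc k)) I ?W ?t" using Cons by (intro tracks_put) auto
  have "\<exists>t'. tracks (max (max H (Suc k)) (Suc k + length us)) I
      (\<lambda>i. if i \<le> Suc k then ?W i else input_tape us (i - Suc k)) t' \<and>
    reaches simulator (length us + 1) (Write us, Suc (Suc k), ?t) (Rewind Fetch, Suc (Suc k + length us), t')"
    by (rule Cons.IH[OF tr]) (use Cons(4) in simp_all)
  then obtain t' where
    t': "tracks (max (max H (Suc k)) (Suc k + length us)) I
      (\<lambda>i. if i \<le> Suc k then ?W i else input_tape us (i - Suc k)) t'"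
    "reaches simulator (length us + 1) (Write us, Suc (Suc k), ?t) (Rewind Fetch, Suc (Suc k + length us), t')"
    by blast
  have "(if i \<le> Suc k then ?W i else input_tape us (i - Suc k)) =
    (if i \<le> k then W i else input_tape (u # us) (i - k))" for i
  proof (cases "Suc k < i")
    case True
    then obtain m where "i = Suc (Suc (k + m))" using less_iff_Suc_add by auto
    then show ?thesis by (simp add: Suc_diff_le)
  next
    case False
    then consider "i = Suc k" | "i \<le> k" by linarith
    then show ?thesis by cases simp_all
  qed
  moreover have "max (max H (Suc k)) (Suc k + length us) = max H (k + length (u # us))" by simp
  ultimately show ?case using t'(1) reaches_first[OF st t'(2)] by auto
qed

definition pending :: "'a list \<Rightarrow> nat \<Rightarrow> nat \<Rightarrow> 'a option" where
  "pending v k i = (if k < i \<and> i \<le> length v then Some (v ! (i - 1)) else None)"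

lemma reaches_start:
  "\<exists>t. tracks (max (length v) (length e)) (pending v 0) (input_tape e) t \<and>
    reaches simulator (2 * length e + 4) (initial simulator, 0, input_tape v) (Fetch, 0, t)"
proof -
  have st: "step simulator (initial simulator, 0, input_tape v) = (Write e, Suc 0, input_tape v)"
  proof -
    have "delta (Write e) (input_tape v 0) = (Write e, input_tape v 0, Move_Right)" by simp
    from step_simulator[of _ "input_tape v" 0, OF this] show ?thesis
      unfolding initial_simulator by (simp only: fun_upd_triv move.simps) simp
  qed
  have "tracks (length v) (pending v 0) (input_tape []) (input_tape v)"
  proof -
    have "pending v 0 = (\<lambda>i. if 0 < i \<and> i \<le> length v then Some (v ! (i - 1)) else None)"
      by (rule ext) (simp add: pending_def)
    then show ?thesis using tracks_input_tape[of v] by simp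
  qed
  from reaches_write[OF this, of 0 e] obtain t where
    t: "tracks (max (length v) (length e)) (pending v 0) (\<lambda>i. if i \<le> 0 then input_tape [] i else input_tape e (i - 0)) t"
    "reaches simulator (length e + 1) (Write e, Suc 0, input_tape v) (Rewind Fetch, Suc (length e), t)"
    by (auto simp: input_tape_beyond)
  have "(\<lambda>i. if i \<le> 0 then input_tape [] i else input_tape e (i - 0)) = (input_tape e :: nat \<Rightarrow> ('s, 'x) symbol)"
    by (auto simp: fun_eq_iff)
  with t(1) have tr: "tracks (max (length v) (length e)) (pending v 0) (input_tape e) t" by simp
  have "reaches simulator (2 * length e + 4) (initial simulator, 0, input_tape v) (Fetch, 0, t)"
    by (rule reaches_mono[OF reaches_trans[OF reaches_first[OF st t(2)] reaches_rewind[OF tr]]]) simp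
  then show ?thesis using tr by blast
qed

section \<open>The running time\<close>

text \<open>
  On inputs of length \<open>n\<close> the words on the work track have length at most
  \<open>|e| + K * max_expansion * n\<close>, so the first two summands bound the running time of each simulated
  machine; the others cover the cells used by the input and by the initial word.
\<close>

definition tape_bound :: "nat \<Rightarrow> nat" where
  "tape_bound n = c * (length e + K * (max_expansion * n)) + c + n + length e"

lemma length_concat_expand:
  "v \<in> lists \<Gamma> \<Longrightarrow> length (concat (map expand v)) \<le> max_expansion * length v"
  using length_expand_le by (induction v) (auto simp: add_le_mono)

lemma concat_expand_closed: "v \<in> lists \<Gamma> \<Longrightarrow> concat (map expand v) \<in> lists S"
  using expand by (induction v) auto

lemma reaches_letters:
  assumes v: "v \<in> lists \<Gamma>" and B: "B = tape_bound (length v)" and k: "k \<le> length v"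
    and t0: "tracks (max (length v) (length e)) (pending v 0) (input_tape e) t0"
  shows "\<exists>H t. H \<le> B \<and> tracks H (pending v k) (input_tape (fold f (concat (map expand (take k v))) e)) t \<and>
    reaches simulator (k * (2 * B + 2 + max_expansion * (5 * B + 8))) (Fetch, 0, t0) (Fetch, 0, t)"
  using k
proof (induction k)
  case 0
  have "max (length v) (length e) \<le> B" by (simp add: B tape_bound_def)
  with t0 have "max (length v) (length e) \<le> B \<and>
      tracks (max (length v) (length e)) (pending v 0) (input_tape (fold f (concat (map expand (take 0 v))) e)) t0 \<and>
      reaches simulator (0 * (2 * B + 2 + max_expansion * (5 * B + 8))) (Fetch, 0, t0) (Fetch, 0, t0)"
    by (simp add: reaches_refl)
  then show ?case by blast
next
  case (Suc k)
  let ?w = "fold f (concat (map expand (take k v))) e" and ?a = "v ! k"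
  obtain H t where IH: "H \<le> B" "tracks H (pending v k) (input_tape ?w) t"
    "reaches simulator (k * (2 * B + 2 + max_expansion * (5 * B + 8))) (Fetch, 0, t0) (Fetch, 0, t)"
    using Suc by auto
  have a: "?a \<in> \<Gamma>" using v Suc.prems by (auto simp: in_lists_conv_set)
  have tk: "take k v \<in> lists \<Gamma>" "take (Suc k) v \<in> lists \<Gamma>" using v by (auto dest: in_set_takeD)
  have take: "take (Suc k) v = take k v @ [?a]" using Suc.prems by (simp add: take_Suc_conv_app_nth)
  have "pending v k (Suc k) = Some ?a" "\<And>i. i < Suc k \<Longrightarrow> pending v k i = None"
    using Suc.prems by (auto simp: pending_def)
  from reaches_fetch[OF IH(2) this IH(1)] obtain t1 where
    1: "tracks H ((pending v k)(Suc k := None)) (input_tape ?w) t1"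
      "reaches simulator (2 * B + 2) (Fetch, 0, t) (next_phase (expand ?a), 0, t1)" by blast
  have pend: "(pending v k)(Suc k := None) = pending v (Suc k)" by (auto simp: pending_def fun_eq_iff)
  have w: "?w \<in> lists \<Sigma>" using fold_f_closed concat_expand_closed[OF tk(1)] e by blast
  have "length ?w + K * length (expand ?a) \<le> length e + K * length (concat (map expand (take (Suc k) v)))"
    using fold_f_length[OF concat_expand_closed[OF tk(1)] e] by (simp add: take algebra_simps)
  also have "\<dots> \<le> length e + K * (max_expansion * length v)"
    using length_concat_expand[OF tk(2)] Suc.prems
    by (intro add_mono mult_le_mono order_refl order_trans[OF length_concat_expand[OF tk(2)]]) auto
  finally have "c * (length ?w + K * length (expand ?a)) \<le> c * (length e + K * (max_expansion * length v))"
    by (rule mult_le_mono2)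
  then have "c * (length ?w + K * length (expand ?a)) + c \<le> B"
    unfolding B tape_bound_def by linarith
  from reaches_fold[OF expand[OF a] w 1(1)[unfolded pend] IH(1) this] obtain H' t' where
    2: "H' \<le> B" "tracks H' (pending v (Suc k)) (input_tape (fold f (expand ?a) ?w)) t'"
      "reaches simulator (length (expand ?a) * (5 * B + 8)) (next_phase (expand ?a), 0, t1) (Fetch, 0, t')" by blast
  have "reaches simulator (max_expansion * (5 * B + 8)) (next_phase (expand ?a), 0, t1) (Fetch, 0, t')"
    by (rule reaches_mono[OF 2(3)]) (use length_expand_le[OF a] in simp)
  from reaches_trans[OF IH(3) reaches_trans[OF 1(2) this]]
  have "reaches simulator (Suc k * (2 * B + 2 + max_expansion * (5 * B + 8))) (Fetch, 0, t0) (Fetch, 0, t')"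
    by (simp add: algebra_simps)
  then show ?case using 2 by (auto simp: take)
qed

lemma reaches_answer:
  assumes v: "v \<in> lists \<Gamma>" and B: "B = tape_bound (length v)"
  shows "\<exists>h t. reaches simulator ((length v + 1) * (5 * B + 10) * (max_expansion + 1)) (initial simulator, 0, input_tape v)
    (if fold f (concat (map expand v)) e = e then Accept else Reject, h, t)"
proof -
  let ?w = "fold f (concat (map expand v)) e"
  obtain t0 where 0: "tracks (max (length v) (length e)) (pending v 0) (input_tape e) t0"
    "reaches simulator (2 * length e + 4) (initial simulator, 0, input_tape v) (Fetch, 0, t0)"
    using reaches_start by blast
  obtain H t where 1: "H \<le> B" "tracks H (pending v (length v)) (input_tape ?w) t"
    "reaches simulator (length v * (2 * B + 2 + max_expansion * (5 * B + 8))) (Fetch, 0, t0) (Fetch, 0, t)"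
    using reaches_letters[OF v B order_refl 0(1)] by auto
  have 2: "reaches simulator (2 * B + 4) (Fetch, 0, t) (Check e, 0, t)"
    by (rule reaches_check_phase[OF 1(2) _ 1(1)]) (simp add: pending_def)
  have "delta (Check e) (t 0) = (Check e, t 0, Move_Right)" using tracksD(1)[OF 1(2), of 0] by simp
  from step_simulator[of _ t "0", OF this] have "step simulator (Check e, 0, t) = (Check e, Suc 0, t)" by simp
  moreover obtain h where "reaches simulator (length e + 1) (Check e, Suc 0, t) (if e = drop 0 ?w then Accept else Reject, h, t)"
    using reaches_verdict[OF 1(2), of 0] by auto
  ultimately have "reaches simulator (Suc (length e + 1)) (Check e, 0, t) (if e = drop 0 ?w then Accept else Reject, h, t)"
    by (rule reaches_first)
  then have 3: "reaches simulator (Suc (length e + 1)) (Check e, 0, t) (if ?w = e then Accept else Reject, h, t)"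
    by (simp only: drop0 eq_commute[of e ?w])
  have e: "length e \<le> B" by (simp add: B tape_bound_def)
  define N where "N = max_expansion"
  have "2 * length e + 4 + length v * (2 * B + 2 + N * (5 * B + 8)) + (2 * B + 4) + Suc (length e + 1)
     \<le> length v * ((5 * B + 10) * (N + 1)) + (5 * B + 10)"
  proof -
    define X where "X = 2 * B + 2 + N * (5 * B + 8)"
    define Y where "Y = (5 * B + 10) * (N + 1)"
    have "X \<le> Y" by (simp add: X_def Y_def algebra_simps)
    then have "length v * X \<le> length v * Y" by simp
    then have "2 * length e + 4 + length v * X + (2 * B + 4) + Suc (length e + 1) \<le> length v * Y + (5 * B + 10)"
      using e by linarith
    then show ?thesis unfolding X_def Y_def .
  qed
  also have "\<dots> \<le> length v * ((5 * B + 10) * (N + 1)) + (5 * B + 10) * (N + 1)" by simp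
  also have "\<dots> = (length v + 1) * (5 * B + 10) * (N + 1)" by (simp add: algebra_simps)
  finally show ?thesis
    using reaches_mono[OF reaches_trans[OF reaches_trans[OF reaches_trans[OF 0(2) 1(3)] 2] 3]]
    unfolding N_def by blast
qed

text \<open>
  There are linearly many letters to fetch and functions to apply, and each of these tasks takes
  time linear in the tape bound, which is itself linear in the input length.
\<close>

theorem quadratic_time_answer:
  "\<exists>D. \<forall>v\<in>lists \<Gamma>. \<exists>n \<le> D * (length v)^2 + D. state_after simulator v n =
     (if fold f (concat (map expand v)) e = e then Accept else Reject)"
proof -
  define N where "N = max_expansion"
  define b where "b = c * (length e + K * N) + c + 1 + length e"
  define D where "D = 2 * ((5 * b + 10) * (N + 1))"
  have "\<exists>n \<le> D * (length v)^2 + D. state_after simulator v n =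
     (if fold f (concat (map expand v)) e = e then Accept else Reject)" if v: "v \<in> lists \<Gamma>" for v
  proof -
    let ?n = "length v"
    have "tape_bound ?n \<le> b * (?n + 1)"
      unfolding tape_bound_def b_def N_def by (simp add: algebra_simps)
    then have "5 * tape_bound ?n + 10 \<le> (5 * b + 10) * (?n + 1)" by (simp add: algebra_simps)
    then have "(?n + 1) * (5 * tape_bound ?n + 10) * (N + 1) \<le> (?n + 1) * ((5 * b + 10) * (?n + 1)) * (N + 1)"
      by (intro mult_le_mono) auto
    also have "\<dots> = (5 * b + 10) * (N + 1) * (?n + 1)^2"
      by (simp only: power2_eq_square mult_ac)
    \<comment> \<open>Brings the bound into the required form without a linear term.\<close>
    also have "(?n + 1)^2 \<le> 2 * ?n^2 + 2"
    proof -
      have "2 * ?n \<le> ?n^2 + 1"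
        using zero_le_power2[of "int ?n - 1"] by (simp add: power2_eq_square algebra_simps flip: of_nat_mult)
      then show ?thesis by (simp add: power2_eq_square)
    qed
    then have "(5 * b + 10) * (N + 1) * (?n + 1)^2 \<le> (5 * b + 10) * (N + 1) * (2 * ?n^2 + 2)"
      by (rule mult_le_mono2)
    also have "\<dots> = D * ?n^2 + D" unfolding D_def by (simp add: algebra_simps)
    finally have bound: "(?n + 1) * (5 * tape_bound ?n + 10) * (N + 1) \<le> D * ?n^2 + D" .
    obtain h t where "reaches simulator (D * ?n^2 + D) (initial simulator, 0, input_tape v)
      (if fold f (concat (map expand v)) e = e then Accept else Reject, h, t)"
      using reaches_answer[OF v refl] reaches_mono[OF _ bound[unfolded N_def]] by blast
    then show ?thesis
      by (auto simp: reaches_def state_after_def config_after_def intro: exI)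
  qed
  then show ?thesis by blast
qed

end

section \<open>Renaming states and symbols\<close>

text \<open>
  Finite sets of states and of work symbols embed into the natural numbers, and a machine never
  leaves its state set and tape alphabet, so that an inverse of the embedding is only applied on
  its range.
\<close>

lemma relabel_to_nat:
  fixes M :: "('q, 's, 'x) tm"
  assumes M: "tm_over \<Sigma> M"
  shows "\<exists>(M' :: (nat, 's, nat) tm) g. tm_over \<Sigma> M' \<and> accepting M' = g ` accepting M \<and>
    rejecting M' = g ` rejecting M \<and> (\<forall>w\<in>lists \<Sigma>. \<forall>n. state_after M' w n = g (state_after M w n))"
proof -
  let ?Q = "states M" and ?T = "tape_alphabet M"
  have fin: "finite ?Q" "finite (Aux -` ?T)"
    using M by (auto simp: tm_over_def intro: finite_vimageI injI)
  obtain g :: "'q \<Rightarrow> nat" where g: "inj_on g ?Q" using finite_imp_inj_to_nat_seg[OF fin(1)] by blast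
  obtain r :: "'x \<Rightarrow> nat" where r: "inj_on r (Aux -` ?T)" using finite_imp_inj_to_nat_seg[OF fin(2)] by blast
  define enc where "enc = map_symbol (id :: 's \<Rightarrow> 's) r"
  have enc: "inj_on enc ?T"
  proof (rule inj_onI)
    fix y z assume "y \<in> ?T" "z \<in> ?T" "enc y = enc z"
    then show "y = z" using r by (cases y; cases z) (auto simp: enc_def inj_on_def)
  qed
  have enc_End: "enc y = End \<longleftrightarrow> y = End" for y by (cases y) (simp_all add: enc_def)
  have enc_simps: "enc End = End" "enc Blank = Blank" "\<And>a. enc (Letter a) = Letter a"
    by (simp_all add: enc_def)
  define M' where "M' = \<lparr> states = g ` ?Q, tape_alphabet = enc ` ?T, initial = g (initial M),
    accepting = g ` accepting M, rejecting = g ` rejecting M,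
    trans = (\<lambda>q y. case trans M (inv_into ?Q g q) (inv_into ?T enc y) of (q', b, d) \<Rightarrow> (g q', enc b, d)) \<rparr>"
  have sub: "halting M \<subseteq> ?Q" using M by (auto simp: tm_over_def halting_def)
  have halt: "g q \<in> halting M' \<longleftrightarrow> q \<in> halting M" if "q \<in> ?Q" for q
  proof -
    have "halting M' = g ` halting M" by (auto simp: halting_def M'_def)
    then show ?thesis using inj_on_image_mem_iff[OF g that sub] by simp
  qed
  have tr: "trans M' (g q) (enc y) = (case trans M q y of (q', b, d) \<Rightarrow> (g q', enc b, d))"
    if "q \<in> ?Q" "y \<in> ?T" for q y
    using that g enc by (simp add: M'_def)
  have "tm_over \<Sigma> M'"
  proof -
    have "finite (states M')" "finite (tape_alphabet M')" "initial M' \<in> states M'"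
      "accepting M' \<subseteq> states M'" "rejecting M' \<subseteq> states M'"
      using M by (auto simp: M'_def tm_over_def)
    moreover have "{End, Blank} \<union> Letter ` \<Sigma> \<subseteq> tape_alphabet M'"
    proof -
      have "{End, Blank} \<union> Letter ` \<Sigma> = enc ` ({End, Blank} \<union> Letter ` \<Sigma>)"
        by (auto simp: enc_simps image_Un image_image)
      also have "\<dots> \<subseteq> enc ` ?T" using M by (intro image_mono) (simp add: tm_over_def)
      finally show ?thesis by (simp add: M'_def)
    qed
    moreover have "accepting M' \<inter> rejecting M' = {}"
      using inj_on_image_Int[OF g, of "accepting M" "rejecting M"] M by (simp add: M'_def tm_over_def)
    moreover have "p' \<in> states M' \<and> b' \<in> tape_alphabet M' \<and> (b' = End \<longleftrightarrow> y' = End) \<and>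
        (y' = End \<longrightarrow> d \<noteq> Move_Left)"
      if asm: "q' \<in> states M' - halting M'" "y' \<in> tape_alphabet M'" "trans M' q' y' = (p', b', d)"
      for q' y' p' b' d
    proof -
      obtain q y where q: "q \<in> ?Q" "q' = g q" and y: "y \<in> ?T" "y' = enc y"
        using asm by (auto simp: M'_def)
      obtain p b d' where t: "trans M q y = (p, b, d')" by (metis prod_cases3)
      have "q \<notin> halting M" using asm(1) q halt by simp
      then have "p \<in> ?Q \<and> b \<in> ?T \<and> (b = End \<longleftrightarrow> y = End) \<and> (y = End \<longrightarrow> d' \<noteq> Move_Left)"
        using M q(1) y(1) t unfolding tm_over_def by (metis DiffI)
      moreover have "p' = g p" "b' = enc b" "d = d'" using asm(3) tr[OF q(1) y(1)] q(2) y(2) t by simp_all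
      ultimately show ?thesis using y(2) by (simp add: enc_End) (simp add: M'_def)
    qed
    then have "\<forall>q'\<in>states M' - halting M'. \<forall>y'\<in>tape_alphabet M'. \<forall>p' b' d.
        trans M' q' y' = (p', b', d) \<longrightarrow> p' \<in> states M' \<and> b' \<in> tape_alphabet M' \<and>
        (b' = End \<longleftrightarrow> y' = End) \<and> (y' = End \<longrightarrow> d \<noteq> Move_Left)"
      by (intro ballI allI impI)
    ultimately show ?thesis unfolding tm_over_def by (intro conjI)
  qed
  moreover have "config_after M' w n = (g (state_after M w n), head_after M w n, enc \<circ> tape_after M w n)"
    if w: "w \<in> lists \<Sigma>" for w n
  proof (induction n)
    case 0
    have "input_tape w = enc \<circ> input_tape w"
    proof
      fix i show "input_tape w i = (enc \<circ> input_tape w) i" by (cases i) (auto simp: enc_simps)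
    qed
    then show ?case by (simp add: config_after_0 M'_def comp_def)
  next
    case (Suc n)
    let ?q = "state_after M w n" and ?h = "head_after M w n" and ?t = "tape_after M w n"
    have within: "?q \<in> ?Q" "?t ?h \<in> ?T" using run_within_machine[OF M w] by auto
    have eq: "config_after M' w (Suc n) = step M' (g ?q, ?h, enc \<circ> ?t)"
      using Suc by (simp only: config_after_Suc)
    show ?case
    proof (cases rule: step_after_cases[of M w n])
      case halted
      then show ?thesis unfolding eq using halt within by (simp add: step.simps comp_def)
    next
      case (moved q b d)
      have "(enc \<circ> ?t)(?h := enc b) = enc \<circ> ?t(?h := b)" by (auto simp: fun_eq_iff)
      then show ?thesis unfolding eq using halt within moved tr[OF within]
        by (simp add: step.simps comp_def del: fun_upd_apply)
    qed
  qed
  then have "\<forall>w\<in>lists \<Sigma>. \<forall>n. state_after M' w n = g (state_after M w n)"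
    by (simp add: state_after_def)
  moreover have "accepting M' = g ` accepting M" "rejecting M' = g ` rejecting M" by (simp_all add: M'_def)
  ultimately show ?thesis by blast
qed

section \<open>Walking in the Cayley graph\<close>

lemma (in monoid) word_value_closed: "w \<in> lists (carrier G) \<Longrightarrow> word_value G w \<in> carrier G"
  by (induction w) (auto simp: word_value_def)

lemma (in monoid) word_value_append:
  "u \<in> lists (carrier G) \<Longrightarrow> w \<in> lists (carrier G) \<Longrightarrow>
    word_value G (u @ w) = word_value G u \<otimes> word_value G w"
proof (induction u)
  case (Cons x u)
  then show ?case using word_value_closed[of u] word_value_closed[of w]
    by (simp add: word_value_def m_assoc)
qed (use word_value_closed[of w] in \<open>simp add: word_value_def\<close>)

lemma (in monoid) word_value_concat_map:
  assumes "v \<in> lists \<Gamma>" "S \<subseteq> carrier G"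
    and "\<And>a. a \<in> \<Gamma> \<Longrightarrow> expand a \<in> lists S \<and> word_value G (expand a) = a"
  shows "word_value G (concat (map expand v)) = word_value G v"
  using assms(1)
proof (induction v rule: list.induct)
  case (Cons a v)
  have S: "lists S \<subseteq> lists (carrier G)" using assms(2) by (rule lists_mono)
  have "concat (map expand v) \<in> lists S" using Cons.prems assms(3) by (induction v rule: list.induct) auto
  then have "word_value G (concat (map expand (a # v))) =
      word_value G (expand a) \<otimes> word_value G (concat (map expand v))"
    using S assms(3)[of a] Cons.prems by (simp add: word_value_append subset_iff del: in_lists_conv_set)
  also have "\<dots> = a \<otimes> word_value G v" using Cons assms(3)[of a] by simp
  finally show ?case by (simp add: word_value_def)
qed (simp add: word_value_def)

text \<open>
  The functions \<open>f s\<close> realise right multiplication, so processing a word from left to right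
  multiplies by its value.
\<close>

lemma (in monoid) cayley_walk:
  assumes S: "S \<subseteq> carrier G" and L: "\<And>w. w \<in> L \<Longrightarrow> \<psi> w \<in> carrier G"
    and f: "\<And>s w. s \<in> S \<Longrightarrow> w \<in> L \<Longrightarrow> f s w \<in> L \<and> \<psi> (f s w) = \<psi> w \<otimes> s"
  shows "u \<in> lists S \<Longrightarrow> w \<in> L \<Longrightarrow> fold f u w \<in> L \<and> \<psi> (fold f u w) = \<psi> w \<otimes> word_value G u"
proof (induction u arbitrary: w)
  case Nil
  then show ?case using L by (simp add: word_value_def)
next
  case (Cons s u)
  have s: "s \<in> S" "u \<in> lists S" using Cons.prems by auto
  have "word_value G u \<in> carrier G" using s(2) S by (intro word_value_closed) auto
  then show ?case
    using Cons.IH[OF s(2), of "f s w"] f[OF s(1) Cons.prems(2)] L[OF Cons.prems(2)] S s(1)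
    by (auto simp: word_value_def m_assoc subset_iff)
qed

text \<open>
  For a finite family the constants can be chosen uniformly, by summing over the family.
\<close>

lemma pf_linear_time_family:
  assumes "finite S" and "\<forall>s\<in>S. pf_linear_time \<Sigma> (f s)"
  shows "\<exists>(M :: 'i \<Rightarrow> (nat, 's, nat) tm) c K. \<forall>s\<in>S. tm_over \<Sigma> (M s) \<and>
    (\<forall>x\<in>lists \<Sigma>. f s x \<in> lists \<Sigma> \<and> length (f s x) \<le> length x + K \<and>
      (\<exists>n \<le> c * length x + c. state_after (M s) x n \<in> accepting (M s) \<and>
        output_on_tape (tape_after (M s) x n) (f s x)))"
proof -
  have pf: "pf_linear_time \<Sigma> (f s)" if "s \<in> S" for s using assms(2) that by blast
  then have "\<forall>s\<in>S. \<exists>M c. tm_over \<Sigma> (M :: (nat, 's, nat) tm) \<and> (\<forall>x\<in>lists \<Sigma>. \<exists>n \<le> c * length x + c.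
      state_after M x n \<in> accepting M \<and> output_on_tape (tape_after M x n) (f s x))"
    unfolding pf_linear_time_def by blast
  then obtain M :: "'i \<Rightarrow> (nat, 's, nat) tm" and c where
    M: "\<And>s. s \<in> S \<Longrightarrow> tm_over \<Sigma> (M s)" and
    run: "\<And>s x. s \<in> S \<Longrightarrow> x \<in> lists \<Sigma> \<Longrightarrow> \<exists>n \<le> c s * length x + c s.
      state_after (M s) x n \<in> accepting (M s) \<and> output_on_tape (tape_after (M s) x n) (f s x)"
    by metis
  have "\<forall>s\<in>S. \<exists>K. \<forall>x\<in>lists \<Sigma>. length (f s x) \<le> length x + K"
    using linear_time_bounded_growth[OF M run] by fast
  then obtain K where K: "\<And>s x. s \<in> S \<Longrightarrow> x \<in> lists \<Sigma> \<Longrightarrow> length (f s x) \<le> length x + K s" by metis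
  define c' K' where "c' = sum c S" and "K' = sum K S"
  have c': "c s \<le> c'" and K': "K s \<le> K'" if "s \<in> S" for s
    using that assms(1) by (auto simp: c'_def K'_def intro: member_le_sum)
  show ?thesis
  proof (rule exI[of _ M], rule exI[of _ c'], rule exI[of _ K'], intro ballI conjI)
    fix s assume s: "s \<in> S"
    show "tm_over \<Sigma> (M s)" using M[OF s] .
    fix x assume x: "x \<in> lists \<Sigma>"
    show "f s x \<in> lists \<Sigma>" using pf[OF s] x by (simp add: pf_linear_time_def del: in_lists_conv_set)
    show "length (f s x) \<le> length x + K'" using K[OF s x] K'[OF s] by linarith
    have "c s * length x + c s \<le> c' * length x + c'" using c'[OF s] by (intro add_mono mult_le_mono) auto
    then show "\<exists>n \<le> c' * length x + c'. state_after (M s) x n \<in> accepting (M s) \<and>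
        output_on_tape (tape_after (M s) x n) (f s x)"
      using run[OF s x] le_trans by blast
  qed
qed

theorem corollary1:
  fixes G (structure) and A :: "'a set"
  assumes "group G"
    and "cayley_pf_linear_time G"
    and "finite A" and "A \<subseteq> carrier G" and "generate G A = carrier G"
  shows "quadratic_time_decidable (signed_letters G A) (word_problem G A)"
proof -
  interpret group G by fact
  let ?\<Gamma> = "signed_letters G A"
  have \<Gamma>: "finite ?\<Gamma>" "?\<Gamma> \<subseteq> carrier G" using assms(3,4) by (auto simp: signed_letters_def)
  obtain S where S: "finite S" "semigroup_generators G S" "cayley_pf_linear_time_wrt G S"
    using assms(2) unfolding cayley_pf_linear_time_def by blast
  obtain \<Sigma> :: "nat set" and L \<psi> f where
    \<Sigma>: "finite \<Sigma>" "L \<subseteq> lists \<Sigma>" and \<psi>: "bij_betw \<psi> L (carrier G)" and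
    steps: "\<forall>s\<in>S. pf_linear_time \<Sigma> (f s) \<and> f s ` L \<subseteq> L \<and> (\<forall>w\<in>L. \<psi> (f s w) = \<psi> w \<otimes> s)"
    using S(3) unfolding cayley_pf_linear_time_wrt_def by (elim exE conjE) (rule that)
  have f: "\<And>s. s \<in> S \<Longrightarrow> pf_linear_time \<Sigma> (f s)"
      "\<And>s w. s \<in> S \<Longrightarrow> w \<in> L \<Longrightarrow> f s w \<in> L \<and> \<psi> (f s w) = \<psi> w \<otimes> s"
    using steps by auto
  have SG: "S \<subseteq> carrier G" and "\<forall>g\<in>carrier G. \<exists>u\<in>lists S. word_value G u = g"
    using S(2) unfolding semigroup_generators_def by auto
  then obtain expand where expansion:
    "\<And>g. g \<in> carrier G \<Longrightarrow> expand g \<in> lists S \<and> word_value G (expand g) = g"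
    by metis
  obtain e where base: "e \<in> L" "\<psi> e = \<one>" using \<psi> by (metis bij_betw_iff_bijections one_closed)
  have pf: "\<forall>s\<in>S. pf_linear_time \<Sigma> (f s)" using f(1) by blast
  obtain M c K where M: "\<forall>s\<in>S. tm_over \<Sigma> (M s :: (nat, nat, nat) tm) \<and>
    (\<forall>x\<in>lists \<Sigma>. f s x \<in> lists \<Sigma> \<and> length (f s x) \<le> length x + K \<and>
      (\<exists>n \<le> c * length x + c. state_after (M s) x n \<in> accepting (M s) \<and>
        output_on_tape (tape_after (M s) x n) (f s x)))"
    using pf_linear_time_family[OF S(1) pf] by (elim exE) (rule that)
  interpret iterated_application ?\<Gamma> expand \<Sigma> e S M f c K
  proof unfold_locales
    show "expand a \<in> lists S" if "a \<in> ?\<Gamma>" for a using expansion \<Gamma>(2) that by blast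
  qed (use \<Gamma>(1) \<Sigma> S(1) base(1) M in blast)+
  have in_L: "\<psi> w \<in> carrier G" if "w \<in> L" for w using \<psi> that by (auto simp: bij_betw_def)
  have answer: "fold f (concat (map expand v)) e = e \<longleftrightarrow> v \<in> word_problem G A" if v: "v \<in> lists ?\<Gamma>" for v
  proof -
    let ?u = "concat (map expand v)"
    have same_value: "word_value G ?u = word_value G v"
      using expansion \<Gamma>(2) by (intro word_value_concat_map[OF v SG]) blast
    have "word_value G v \<in> carrier G" using v \<Gamma>(2) by (intro word_value_closed) auto
    then have walk: "fold f ?u e \<in> L" "\<psi> (fold f ?u e) = word_value G v"
      using cayley_walk[OF SG in_L f(2) concat_expand_closed[OF v] base(1)] same_value base(2) by auto
    have "fold f ?u e = e \<longleftrightarrow> \<psi> (fold f ?u e) = \<psi> e"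
      using \<psi> walk(1) base(1) by (auto simp: bij_betw_def inj_on_def)
    also have "\<dots> \<longleftrightarrow> v \<in> word_problem G A" using walk(2) base(2) v by (simp add: word_problem_def)
    finally show ?thesis .
  qed
  obtain D where D: "\<And>v. v \<in> lists ?\<Gamma> \<Longrightarrow> \<exists>n \<le> D * (length v)^2 + D. state_after simulator v n =
     (if fold f (concat (map expand v)) e = e then Accept else Reject)"
    using quadratic_time_answer by blast
  obtain N :: "(nat, 'a, nat) tm" and g where N: "tm_over ?\<Gamma> N" "accepting N = g ` accepting simulator"
    "rejecting N = g ` rejecting simulator" "\<forall>v\<in>lists ?\<Gamma>. \<forall>n. state_after N v n = g (state_after simulator v n)"
    using relabel_to_nat[OF tm_over_simulator] by (elim exE conjE) (rule that)
  show ?thesis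
    unfolding quadratic_time_decidable_def
  proof (rule exI[of _ N], rule exI[of _ D], intro conjI ballI N(1))
    fix v assume v: "v \<in> lists ?\<Gamma>"
    from D[OF v] obtain n where n: "n \<le> D * (length v)^2 + D"
      "state_after simulator v n = (if v \<in> word_problem G A then Accept else Reject)"
      unfolding answer[OF v] by blast
    then have "state_after N v n \<in> (if v \<in> word_problem G A then accepting N else rejecting N)"
      using N(2-4) v by (auto simp: simulator_def)
    with n(1) show "\<exists>n \<le> D * (length v)^2 + D.
        state_after N v n \<in> (if v \<in> word_problem G A then accepting N else rejecting N)" by blast
  qed
qed

end
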